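(* Let $u:\bar\Delta_n\to\mathbb{R}^N$ be an extremizer (minimizer or maximizer) of $$\mathcal{J}[u]=\int_{\Delta_n}F\big(t,u(t),\nabla^{\boldsymbol\alpha}_{B_{P^1}}u(t),\nabla u(t)\big)\,dt_n\cdots dt_1$$ among all $u\in C^1(\bar\Delta_n;\mathbb{R}^N)$ such that each $B^{\alpha_i}_{P^1_{t_i}}u$ is continuous on $\bar\Delta_n$ and $u=\psi$ on $\partial\Delta_n$, where $\psi:\partial\Delta_n\to\mathbb{R}^N$ is given. Assume that for all $i,k$, $K^{1-\alpha_i}_{P^{1*}_{t_i}}\big(\partial_{v_{k,i}}F\{u\}\big)\in C^1(\bar\Delta_n)$ and $t\mapsto\partial_{w_{k,i}}F\{u\}(t)$ belongs to $C^1(\bar\Delta_n)$. Then for each $k=1,\dots,N$ and all $t\in\Delta_n$, $$\sum_{i=1}^n\Big[A^{\alpha_i}_{P^{1*}_{t_i}}\Big(\partial_{v_{k,i}}F\{u\}\Big)(t)+\frac{\partial}{\partial t_i}\Big(\partial_{w_{k,i}}F\{u\}\Big)(t)\Big]=\partial_{x_k}F\{u\}(t).$$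
   Context: Fix $n,N\in\mathbb{N}$, real numbers $a_i<b_i$, $\Delta_n=(a_1,b_1)\times\cdots\times(a_n,b_n)$ with closure $\bar\Delta_n$, $t=(t_1,\dots,t_n)$. For each order $\gamma\in(0,1)$ a kernel $k_\gamma$ is given, a difference kernel: $k_\gamma(s,\tau)=k_\gamma(s-\tau)$. A parameter set is $P_{t_i}=\langle a_i,t_i,b_i,p_i,q_i\rangle$ ($p_i,q_i\in\mathbb{R}$), with dual $P^*_{t_i}=\langle a_i,t_i,b_i,q_i,p_i\rangle$. For $f:\bar\Delta_n\to\mathbb{R}$: $K^{\gamma}_{P_{t_i}}f(t)=p_i\int_{a_i}^{t_i}k_\gamma(t_i-\tau)f(t_1,\dots,\tau,\dots,t_n)d\tau+q_i\int_{t_i}^{b_i}k_\gamma(\tau-t_i)f(t_1,\dots,\tau,\dots,t_n)d\tau$ ($\tau$ in the $i$-th slot); $A^{\alpha}_{P_{t_i}}f=\frac{\partial}{\partial t_i}K^{1-\alpha}_{P_{t_i}}f$; $B^{\alpha}_{P_{t_i}}f=K^{1-\alpha}_{P_{t_i}}\frac{\partial f}{\partial t_i}$; componentwise on vector functions. Here $\boldsymbol\alpha\in(0,1)^n$, $P^1=(P^1_{t_1},\dots,P^1_{t_n})$ with $P^1_{t_i}=\langle a_i,t_i,b_i,p^1_i,q^1_i\rangle$, and $k_{1-\alpha_i}\in L_1((0,b_i-a_i);\mathbb{R})$. $\nabla^{\boldsymbol\alpha}_{B_{P^1}}u$ is the $N\times n$ array with entries $B^{\alpha_i}_{P^1_{t_i}}u_k$,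 and $\nabla u$ the $N\times n$ array of classical partial derivatives $\partial u_k/\partial t_i$. $F(t,x,v,w)$, with $t\in\bar\Delta_n$, $x\in\mathbb{R}^N$, $v=(v_{k,i}),w=(w_{k,i})\in\mathbb{R}^{N\times n}$, is of class $C^2$; $F\{u\}(t)$ denotes evaluation at $(t,u(t),\nabla^{\boldsymbol\alpha}_{B_{P^1}}u(t),\nabla u(t))$. *)

theory Defs
  imports "HOL-Analysis.Analysis"
begin

definition vupd :: "real^'n \<Rightarrow> 'n \<Rightarrow> real \<Rightarrow> real^'n" where
  "vupd t i s = (\<chi> j. if j = i then s else t $ j)"

definition pd :: "real^'n \<Rightarrow> real^'n \<Rightarrow> 'n \<Rightarrow> (real^'n \<Rightarrow> real) \<Rightarrow> real^'n \<Rightarrow> real" where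
  "pd a b i f t = vector_derivative (\<lambda>s. f (vupd t i s)) (at (t $ i) within {a $ i .. b $ i})"

definition C1cl :: "real^'n \<Rightarrow> real^'n \<Rightarrow> (real^'n \<Rightarrow> real) \<Rightarrow> bool" where
  "C1cl a b f \<longleftrightarrow> continuous_on (cbox a b) f \<and>
     (\<forall>i. \<forall>t\<in>cbox a b. (\<lambda>s. f (vupd t i s)) differentiable (at (t $ i) within {a $ i .. b $ i})) \<and>
     (\<forall>i. continuous_on (cbox a b) (pd a b i f))"

definition C2_on :: "'a::real_normed_vector set \<Rightarrow> ('a \<Rightarrow> real) \<Rightarrow> bool" where
  "C2_on S G \<longleftrightarrow> (\<exists>(G1 :: 'a \<Rightarrow> 'a \<Rightarrow>\<^sub>L real) (G2 :: 'a \<Rightarrow> 'a \<Rightarrow>\<^sub>L ('a \<Rightarrow>\<^sub>L real)).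
     (\<forall>z\<in>S. (G has_derivative blinfun_apply (G1 z)) (at z within S)) \<and>
     (\<forall>z\<in>S. (G1 has_derivative blinfun_apply (G2 z)) (at z within S)) \<and>
     continuous_on S G2)"

text \<open>The operator K^gamma_{P_{t_i}} with P_{t_i} = <a_i,t_i,b_i,p,q> and kernel
  kern gamma (a difference kernel, kern gamma s = k_gamma(s)).\<close>
definition Kop :: "(real \<Rightarrow> real \<Rightarrow> real) \<Rightarrow> real \<Rightarrow> real^'n \<Rightarrow> real^'n \<Rightarrow> real \<Rightarrow> real \<Rightarrow> 'n
    \<Rightarrow> (real^'n \<Rightarrow> real) \<Rightarrow> real^'n \<Rightarrow> real" where
  "Kop kern \<gamma> a b p q i f t =
     p * integral {a $ i .. t $ i} (\<lambda>\<tau>. kern \<gamma> (t $ i - \<tau>) * f (vupd t i \<tau>)) +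
     q * integral {t $ i .. b $ i} (\<lambda>\<tau>. kern \<gamma> (\<tau> - t $ i) * f (vupd t i \<tau>))"

definition Aop :: "(real \<Rightarrow> real \<Rightarrow> real) \<Rightarrow> real \<Rightarrow> real^'n \<Rightarrow> real^'n \<Rightarrow> real \<Rightarrow> real \<Rightarrow> 'n
    \<Rightarrow> (real^'n \<Rightarrow> real) \<Rightarrow> real^'n \<Rightarrow> real" where
  "Aop kern \<alpha> a b p q i f t = pd a b i (Kop kern (1 - \<alpha>) a b p q i f) t"

definition Bop :: "(real \<Rightarrow> real \<Rightarrow> real) \<Rightarrow> real \<Rightarrow> real^'n \<Rightarrow> real^'n \<Rightarrow> real \<Rightarrow> real \<Rightarrow> 'n
    \<Rightarrow> (real^'n \<Rightarrow> real) \<Rightarrow> real^'n \<Rightarrow> real" where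
  "Bop kern \<alpha> a b p q i f t = Kop kern (1 - \<alpha>) a b p q i (pd a b i f) t"

definition fgrad :: "(real \<Rightarrow> real \<Rightarrow> real) \<Rightarrow> real^'n \<Rightarrow> real^'n \<Rightarrow> real^'n \<Rightarrow> real^'n \<Rightarrow> real^'n
    \<Rightarrow> (real^'n \<Rightarrow> real^'m) \<Rightarrow> real^'n \<Rightarrow> real^'n^'m" where
  "fgrad kern \<alpha> a b p1 q1 u t = (\<chi> k. \<chi> i. Bop kern (\<alpha> $ i) a b (p1 $ i) (q1 $ i) i (\<lambda>s. u s $ k) t)"

definition cgrad :: "real^'n \<Rightarrow> real^'n \<Rightarrow> (real^'n \<Rightarrow> real^'m) \<Rightarrow> real^'n \<Rightarrow> real^'n^'m" where
  "cgrad a b u t = (\<chi> k. \<chi> i. pd a b i (\<lambda>s. u s $ k) t)"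

definition dFx :: "(real^'n \<Rightarrow> real^'m \<Rightarrow> real^'n^'m \<Rightarrow> real^'n^'m \<Rightarrow> real) \<Rightarrow> 'm
    \<Rightarrow> real^'n \<Rightarrow> real^'m \<Rightarrow> real^'n^'m \<Rightarrow> real^'n^'m \<Rightarrow> real" where
  "dFx F k t x v w = deriv (\<lambda>s. F t (vupd x k s) v w) (x $ k)"

definition dFv :: "(real^'n \<Rightarrow> real^'m \<Rightarrow> real^'n^'m \<Rightarrow> real^'n^'m \<Rightarrow> real) \<Rightarrow> 'm \<Rightarrow> 'n
    \<Rightarrow> real^'n \<Rightarrow> real^'m \<Rightarrow> real^'n^'m \<Rightarrow> real^'n^'m \<Rightarrow> real" where
  "dFv F k i t x v w = deriv (\<lambda>s. F t x (\<chi> k'. if k' = k then vupd (v $ k) i s else v $ k') w) (v $ k $ i)"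

definition dFw :: "(real^'n \<Rightarrow> real^'m \<Rightarrow> real^'n^'m \<Rightarrow> real^'n^'m \<Rightarrow> real) \<Rightarrow> 'm \<Rightarrow> 'n
    \<Rightarrow> real^'n \<Rightarrow> real^'m \<Rightarrow> real^'n^'m \<Rightarrow> real^'n^'m \<Rightarrow> real" where
  "dFw F k i t x v w = deriv (\<lambda>s. F t x v (\<chi> k'. if k' = k then vupd (w $ k) i s else w $ k')) (w $ k $ i)"

definition admissible :: "(real \<Rightarrow> real \<Rightarrow> real) \<Rightarrow> real^'n \<Rightarrow> real^'n \<Rightarrow> real^'n \<Rightarrow> real^'n \<Rightarrow> real^'n
    \<Rightarrow> (real^'n \<Rightarrow> real^'m) \<Rightarrow> (real^'n \<Rightarrow> real^'m) \<Rightarrow> bool" where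
  "admissible kern \<alpha> a b p1 q1 \<psi> u \<longleftrightarrow>
     (\<forall>k. C1cl a b (\<lambda>t. u t $ k)) \<and>
     (\<forall>k i. continuous_on (cbox a b) (Bop kern (\<alpha> $ i) a b (p1 $ i) (q1 $ i) i (\<lambda>t. u t $ k))) \<and>
     (\<forall>t \<in> cbox a b - box a b. u t = \<psi> t)"

definition Jfun :: "(real \<Rightarrow> real \<Rightarrow> real) \<Rightarrow> real^'n \<Rightarrow> real^'n \<Rightarrow> real^'n \<Rightarrow> real^'n \<Rightarrow> real^'n
    \<Rightarrow> (real^'n \<Rightarrow> real^'m \<Rightarrow> real^'n^'m \<Rightarrow> real^'n^'m \<Rightarrow> real) \<Rightarrow> (real^'n \<Rightarrow> real^'m) \<Rightarrow> real" where
  "Jfun kern \<alpha> a b p1 q1 F u =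
     integral (box a b) (\<lambda>t. F t (u t) (fgrad kern \<alpha> a b p1 q1 u t) (cgrad a b u t))"

end

(* Perturb u in one component k by a small multiple of the C^1 bump
   eta(x) = max(0, r^2 - |x - c|^2)^2, supported inside the box. The derivative of the functional
   at 0 vanishes, and it is the integral of
   F_x eta + sum_i (F_v B eta + F_w d_i eta).
   After extension by zero the operators K_P are combinations of convolutions with an L^1 kernel
   along a coordinate line. Hence K_P(d_i eta) is continuous, so the perturbation is admissible, and
   Fubini with translation invariance moves K_P onto F_v as the dual K_{P*}. Integration by parts
   follows since the integral of a difference quotient of a compactly supported function is zero.
   Concentrating eta at c gives the equation at c. *)
theory Submission
  imports Defs
begin

text \<open>The kernel is only integrable, possibly singular at 0, and the limits of integration in
  \<open>Kop\<close> move with \<open>t\<close>. Extending the operand by zero and cutting the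
  kernel off outside \<open>{0<..<b $ i - a $ i}\<close> fixes the domain of integration: both
  one-sided integrals become one object \<open>line_conv\<close> with a direction sign \<sigma>, and
  passing to the adjoint changes this sign. The price is that a zero extension may jump at the
  boundary of the box. Continuity of convolutions is therefore drawn from the test function, whose
  support lies in the interior, while the extension of F_v is handled as a bounded integrable
  function. The derivatives in \<open>C1cl\<close> are taken along coordinate lines and are
  one-sided at the faces. Integration by parts is based on translation along one axis because this
  asks for a derivative in that direction only and does not slice the box. A single square in the
  bump suffices since only first derivatives of the test function enter.\<close>

section \<open>Coordinate lines and one-sided partial derivatives on a closed box\<close>

lemma vupd_eq_add_axis: "vupd t i s = t + (s - t $ i) *\<^sub>R axis i 1"
  by (simp add: vupd_def vec_eq_iff axis_def)

lemma vupd_triv [simp]: "vupd t i (t $ i) = t"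
  by (simp add: vupd_eq_add_axis)

lemma vupd_vupd [simp]: "vupd (vupd t i s) i r = vupd t i r"
  by (simp add: vupd_def vec_eq_iff)

lemma vupd_nth [simp]: "vupd t i s $ j = (if j = i then s else t $ j)"
  by (simp add: vupd_def)

lemma vupd_in_cbox_iff:
  assumes "t \<in> cbox a b"
  shows "vupd t i s \<in> cbox a b \<longleftrightarrow> s \<in> {a $ i..b $ i}"
  using assms by (auto simp: mem_box_cart)

lemma nth_in_interval:
  fixes t :: "real^'n"
  assumes "t \<in> cbox a b"
  shows "t $ i \<in> {a $ i..b $ i}"
  using assms by (auto simp: mem_box_cart)

text \<open>The interval is nondegenerate, so a derivative within it is unique even at its end
  points; hence the choice made by \<open>vector_derivative\<close> in \<open>pd\<close> is the
  derivative at hand.\<close>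

lemma has_vector_derivative_imp_pd_eq:
  assumes "a $ i < b $ i" "t \<in> cbox a b"
    and "((\<lambda>s. f (vupd t i s)) has_vector_derivative D) (at (t $ i) within {a $ i..b $ i})"
  shows "pd a b i f t = D"
  unfolding pd_def
  using assms nth_in_interval[of t a b i] by (intro vector_derivative_within_closed_interval) auto

lemma C1cl_has_vector_derivative_pd:
  assumes "C1cl a b f" "t \<in> cbox a b"
  shows "((\<lambda>s. f (vupd t i s)) has_vector_derivative pd a b i f t) (at (t $ i) within {a $ i..b $ i})"
  using assms unfolding C1cl_def pd_def by (simp add: vector_derivative_works[symmetric])

lemma pd_add_scaled:
  assumes "a $ i < b $ i" "C1cl a b f" "C1cl a b g" "t \<in> cbox a b"
  shows "pd a b i (\<lambda>t. f t + c * g t) t = pd a b i f t + c * pd a b i g t"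
  using assms
  by (intro has_vector_derivative_imp_pd_eq)
     (auto intro!: derivative_intros C1cl_has_vector_derivative_pd
       has_vector_derivative_mult_right)

lemma C1cl_add_scaled:
  assumes ab: "\<forall>i. a $ i < b $ i" and "C1cl a b f" "C1cl a b g"
  shows "C1cl a b (\<lambda>t. f t + c * g t)"
proof -
  have "continuous_on (cbox a b) (pd a b i (\<lambda>t. f t + c * g t))" for i
  proof -
    have "continuous_on (cbox a b) (\<lambda>t. pd a b i f t + c * pd a b i g t)"
      using assms by (auto simp: C1cl_def intro!: continuous_intros)
    then show ?thesis
      using assms by (subst continuous_on_cong[OF refl pd_add_scaled]) auto
  qed
  then show ?thesis
    using assms by (auto simp: C1cl_def intro!: continuous_intros derivative_intros)
qed

section \<open>Partial fractional integrals as convolutions along a line\<close>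

text \<open>Written with \<open>indicator\<close> and \<open>*\<^sub>R\<close> to have the shape of
  the integrands in the theory of set integrals.\<close>

definition zero_ext :: "real^'n \<Rightarrow> real^'n \<Rightarrow> (real^'n \<Rightarrow> real) \<Rightarrow> real^'n \<Rightarrow> real" where
  "zero_ext a b f x = indicator (cbox a b) x *\<^sub>R f x"

text \<open>The substitution \<open>\<tau> = t $ i + \<sigma> * s\<close> makes \<open>s\<close> the
  distance from the base point, so that the integrals to its left and to its right share one kernel
  and one domain that does not depend on \<open>t\<close>.\<close>

definition line_conv :: "(real \<Rightarrow> real) \<Rightarrow> real \<Rightarrow> 'n \<Rightarrow> (real^'n \<Rightarrow> real) \<Rightarrow> real^'n \<Rightarrow> real" where
  "line_conv k \<sigma> i f t = (LINT s|lborel. k s * f (t + (\<sigma> * s) *\<^sub>R axis i 1))"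

lemma zero_ext_integrable:
  assumes "continuous_on (cbox a b) f"
  shows "integrable lborel (zero_ext a b f)"
  using borel_integrable_compact[OF compact_cbox assms] by (simp add: zero_ext_def[abs_def])

lemma zero_ext_measurable:
  assumes "continuous_on (cbox a b) f"
  shows "zero_ext a b f \<in> borel_measurable borel"
  using zero_ext_integrable[OF assms] by auto

lemma zero_ext_bounded:
  assumes "continuous_on (cbox a b) f"
  obtains M where "\<And>x. \<bar>zero_ext a b f x\<bar> \<le> M"
proof -
  have "bounded (f ` cbox a b)"
    using assms by (intro compact_imp_bounded compact_continuous_image compact_cbox)
  then obtain M where M: "M > 0" "\<And>x. x \<in> cbox a b \<Longrightarrow> \<bar>f x\<bar> \<le> M"
    unfolding bounded_pos by auto
  have "\<bar>zero_ext a b f x\<bar> \<le> M" for x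
    using M(1) M(2)[of x] by (simp add: zero_ext_def split: split_indicator)
  with that show ?thesis by blast
qed

text \<open>Passage from the gauge integral, in which operators and functional are stated, to the
  Bochner integral on the whole space, which is the setting for Fubini, translation and dominated
  convergence here.\<close>

lemma integral_cbox_eq_lborel:
  assumes "continuous_on (cbox a b) f"
  shows "integral (cbox a b) f = (LINT x|lborel. zero_ext a b f x)"
  using set_borel_integral_eq_integral(2)[of "cbox a b" f] borel_integrable_compact[OF compact_cbox assms]
  by (simp add: set_integrable_def set_lebesgue_integral_def zero_ext_def)

text \<open>A sup bound on \<open>f\<close> is assumed because integrability over the whole space
  says nothing about a single line.\<close>

lemma line_conv_integrable:
  fixes f :: "real^'n \<Rightarrow> real"
  assumes k: "integrable lborel k" and f: "f \<in> borel_measurable borel" and M: "\<And>x. \<bar>f x\<bar> \<le> M"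
  shows "integrable lborel (\<lambda>s. k s * f (t + (\<sigma> * s) *\<^sub>R axis i 1))"
proof (rule Bochner_Integration.integrable_bound)
  show "integrable lborel (\<lambda>s. k s * M)" using k by simp
  note [measurable] = f borel_measurable_integrable[OF k]
  show "(\<lambda>s. k s * f (t + (\<sigma> * s) *\<^sub>R axis i 1)) \<in> borel_measurable lborel" by measurable
  show "AE s in lborel. norm (k s * f (t + (\<sigma> * s) *\<^sub>R axis i 1)) \<le> norm (k s * M)"
    using M by (auto simp: abs_mult intro!: mult_left_mono order_trans[OF M])
qed

lemma line_conv_add_scaled:
  fixes f g :: "real^'n \<Rightarrow> real"
  assumes "integrable lborel k" "continuous_on (cbox a b) f" "continuous_on (cbox a b) g"
  shows "line_conv k \<sigma> i (zero_ext a b (\<lambda>x. f x + c * g x)) t =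
    line_conv k \<sigma> i (zero_ext a b f) t + c * line_conv k \<sigma> i (zero_ext a b g) t"
proof -
  obtain M M' where "\<And>x. \<bar>zero_ext a b f x\<bar> \<le> M" "\<And>x. \<bar>zero_ext a b g x\<bar> \<le> M'"
    using assms(2,3) zero_ext_bounded by metis
  then have "integrable lborel (\<lambda>s. k s * zero_ext a b f (t + (\<sigma> * s) *\<^sub>R axis i 1))"
    "integrable lborel (\<lambda>s. k s * zero_ext a b g (t + (\<sigma> * s) *\<^sub>R axis i 1))"
    using assms by (auto intro!: line_conv_integrable zero_ext_measurable)
  moreover have "zero_ext a b (\<lambda>x. f x + c * g x) x = zero_ext a b f x + c * zero_ext a b g x" for x
    by (simp add: zero_ext_def algebra_simps)
  ultimately show ?thesis
    unfolding line_conv_def integral_mult_right_zero[symmetric]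
    by (subst Bochner_Integration.integral_add[symmetric])
       (auto simp: algebra_simps intro!: Bochner_Integration.integral_cong)
qed

text \<open>The variable \<open>t\<close> enters through \<open>f\<close> alone, so dominated
  convergence with the majorant \<open>\<bar>k s\<bar> * M\<close> works for any integrable kernel,
  however singular.\<close>

lemma continuous_on_line_conv:
  fixes f :: "real^'n \<Rightarrow> real"
  assumes k: "integrable lborel k" and f: "continuous_on UNIV f" and M: "\<And>x. \<bar>f x\<bar> \<le> M"
  shows "continuous_on S (line_conv k \<sigma> i f)"
proof -
  have "continuous_on UNIV (line_conv k \<sigma> i f)"
    unfolding continuous_on_sequentially comp_def
  proof (intro ballI allI impI)
    fix t :: "real^'n" and X
    assume X: "(\<forall>n. X n \<in> UNIV) \<and> X \<longlonglongrightarrow> t"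
    have [measurable]: "f \<in> borel_measurable borel"
      using f by (rule borel_measurable_continuous_onI)
    note [measurable] = borel_measurable_integrable[OF k]
    show "(\<lambda>n. line_conv k \<sigma> i f (X n)) \<longlonglongrightarrow> line_conv k \<sigma> i f t"
      unfolding line_conv_def
    proof (rule integral_dominated_convergence)
      show "integrable lborel (\<lambda>s. \<bar>k s\<bar> * M)" using k by simp
      show "AE s in lborel. norm (k s * f (X n + (\<sigma> * s) *\<^sub>R axis i 1)) \<le> \<bar>k s\<bar> * M" for n
        using M by (auto simp: abs_mult intro!: mult_left_mono)
      have "(\<lambda>n. k s * f (X n + (\<sigma> * s) *\<^sub>R axis i 1)) \<longlonglongrightarrow> k s * f (t + (\<sigma> * s) *\<^sub>R axis i 1)" for s
        using X by (intro tendsto_intros continuous_on_tendsto_compose[OF f]) auto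
      then show "AE s in lborel. (\<lambda>n. k s * f (X n + (\<sigma> * s) *\<^sub>R axis i 1)) \<longlonglongrightarrow> k s * f (t + (\<sigma> * s) *\<^sub>R axis i 1)"
        by simp
    qed measurable
  qed
  then show ?thesis by (rule continuous_on_subset) simp
qed

lemma lborel_integral_translation:
  fixes f :: "'a::euclidean_space \<Rightarrow> real"
  assumes "f \<in> borel_measurable borel"
  shows "(LINT x|lborel. f (x + c)) = (LINT x|lborel. f x)"
proof -
  have "(LINT x|lborel. f x) = (LINT x|distr lborel borel ((+) c). f x)"
    by (simp add: lborel_distr_plus)
  also have "\<dots> = (LINT x|lborel. f (c + x))"
    using assms by (intro integral_distr) auto
  finally show ?thesis by (simp add: add.commute)
qed

text \<open>For fixed \<open>s\<close>, shifting \<open>t\<close> moves the translation by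
  \<open>\<sigma> * s\<close> from \<open>f\<close> to \<open>g\<close> and reverses it.
  Integrability of \<open>g\<close> together with a bound on \<open>f\<close> gives the absolute
  integrability on the product that both interchanges require.\<close>

lemma line_conv_adjoint:
  fixes f g :: "real^'n \<Rightarrow> real"
  assumes k: "integrable lborel k" and g: "integrable lborel g"
    and f: "f \<in> borel_measurable borel" and M: "\<And>x. \<bar>f x\<bar> \<le> M"
  shows "(LINT t|lborel. g t * line_conv k \<sigma> i f t) = (LINT t|lborel. line_conv k (- \<sigma>) i g t * f t)"
proof -
  note [measurable] = borel_measurable_integrable[OF k] borel_measurable_integrable[OF g] f
  have g2: "integrable lborel (\<lambda>t. g (t - c))" for c
    using g lborel_distr_plus[of "- c"] integrable_distr[of "(+) (- c)" lborel borel g]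
    by (simp add: add.commute)
  have kg: "integrable (lborel \<Otimes>\<^sub>M lborel) (\<lambda>(s, t). k s * g t)"
    using k g by (intro lborel_pair.Fubini_integrable) (auto simp: abs_mult)
  have 1: "integrable (lborel \<Otimes>\<^sub>M lborel) (\<lambda>(s, t). k s * (g t * f (t + (\<sigma> * s) *\<^sub>R axis i 1)))"
  proof (rule Bochner_Integration.integrable_bound)
    show "integrable (lborel \<Otimes>\<^sub>M lborel) (\<lambda>z. (case z of (s, t) \<Rightarrow> k s * g t) * M)"
      using kg by simp
    have "norm (k s * (g t * f (t + (\<sigma> * s) *\<^sub>R axis i 1))) \<le> norm (k s * g t * M)" for s t
      using M by (auto simp: abs_mult mult.assoc intro!: mult_left_mono order_trans[OF M])
    then show "AE z in lborel \<Otimes>\<^sub>M lborel. norm (case z of (s, t) \<Rightarrow> k s * (g t * f (t + (\<sigma> * s) *\<^sub>R axis i 1))) \<le>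
        norm ((case z of (s, t) \<Rightarrow> k s * g t) * M)"
      by auto
  qed measurable
  have 2: "integrable (lborel \<Otimes>\<^sub>M lborel) (\<lambda>(s, t). k s * (g (t + (- \<sigma> * s) *\<^sub>R axis i 1) * f t))"
  proof (rule Bochner_Integration.integrable_bound)
    \<comment> \<open>The inner norm does not depend on the shift, hence not on \<open>s\<close>,
      and the outer integrand is a constant multiple of \<open>\<bar>k s\<bar>\<close>.\<close>
    have "(LINT t|lborel. \<bar>g (t - c)\<bar>) = (LINT t|lborel. \<bar>g t\<bar>)" for c
      using lborel_integral_translation[of "\<lambda>t. \<bar>g t\<bar>" "- c"] by simp
    then have "integrable (lborel \<Otimes>\<^sub>M lborel) (\<lambda>(s, t). k s * g (t + (- \<sigma> * s) *\<^sub>R axis i 1))"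
      using k g2 by (intro lborel_pair.Fubini_integrable) (auto simp: abs_mult)
    then show "integrable (lborel \<Otimes>\<^sub>M lborel) (\<lambda>z. (case z of (s, t) \<Rightarrow> k s * g (t + (- \<sigma> * s) *\<^sub>R axis i 1)) * M)"
      by simp
    have "norm (k s * (g (t + (- \<sigma> * s) *\<^sub>R axis i 1) * f t)) \<le> norm (k s * g (t + (- \<sigma> * s) *\<^sub>R axis i 1) * M)" for s t
      using M by (auto simp: abs_mult mult.assoc intro!: mult_left_mono order_trans[OF M])
    then show "AE z in lborel \<Otimes>\<^sub>M lborel. norm (case z of (s, t) \<Rightarrow> k s * (g (t + (- \<sigma> * s) *\<^sub>R axis i 1) * f t)) \<le>
        norm ((case z of (s, t) \<Rightarrow> k s * g (t + (- \<sigma> * s) *\<^sub>R axis i 1)) * M)"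
      by auto
  qed measurable
  have "(LINT t|lborel. g t * line_conv k \<sigma> i f t) =
      (LINT t|lborel. LINT s|lborel. k s * (g t * f (t + (\<sigma> * s) *\<^sub>R axis i 1)))"
    unfolding line_conv_def integral_mult_right_zero[symmetric] by (simp add: mult_ac)
  also have "\<dots> = (LINT s|lborel. LINT t|lborel. k s * (g t * f (t + (\<sigma> * s) *\<^sub>R axis i 1)))"
    by (rule lborel_pair.Fubini_integral[OF 1])
  also have "\<dots> = (LINT s|lborel. LINT t|lborel. k s * (g (t + (- \<sigma> * s) *\<^sub>R axis i 1) * f t))"
  proof (rule Bochner_Integration.integral_cong[OF refl])
    fix s
    show "(LINT t|lborel. k s * (g t * f (t + (\<sigma> * s) *\<^sub>R axis i 1))) =
        (LINT t|lborel. k s * (g (t + (- \<sigma> * s) *\<^sub>R axis i 1) * f t))"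
      using lborel_integral_translation[of "\<lambda>t. k s * (g (t + (- \<sigma> * s) *\<^sub>R axis i 1) * f t)" "(\<sigma> * s) *\<^sub>R axis i 1"]
      by simp
  qed
  \<comment> \<open>The convolution of \<open>g\<close> may diverge for some \<open>t\<close>, where
    the integral defaults to 0; Fubini confines the divergence of the full integrand to a null
    set.\<close>
  also have "\<dots> = (LINT t|lborel. LINT s|lborel. k s * (g (t + (- \<sigma> * s) *\<^sub>R axis i 1) * f t))"
    by (rule lborel_pair.Fubini_integral[OF 2, symmetric])
  also have "\<dots> = (LINT t|lborel. line_conv k (- \<sigma>) i g t * f t)"
    unfolding line_conv_def integral_mult_left_zero[symmetric] by (simp add: mult_ac)
  finally show ?thesis .
qed

text \<open>Fubini on the product of two copies of \<^const>\<open>lborel\<close> needs a Borel kernel, while the given one is only Lebesgue measurable.\<close>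

lemma absolutely_integrable_Borel_version:
  fixes k :: "real \<Rightarrow> real"
  assumes "k absolutely_integrable_on {0<..<L}"
  obtains k' where "integrable lborel k'" "\<forall>s. s \<notin> {0<..<L} \<longrightarrow> k' s = 0"
    "negligible {s \<in> {0<..<L}. k s \<noteq> k' s}"
proof -
  define h where "h = (\<lambda>s. indicator {0<..<L} s *\<^sub>R k s)"
  have h: "integrable lebesgue h"
    using assms by (simp add: set_integrable_def h_def)
  then obtain g where g [measurable]: "g \<in> borel_measurable lborel" and gh: "AE s in lborel. h s = g s"
    using completion_ex_borel_measurable_real[of h lborel] by auto
  \<comment> \<open>The function \<open>g\<close> agrees with the cut-off kernel only almost
    everywhere; the indicator makes it vanish at every point outside the interval.\<close>
  define k' where "k' = (\<lambda>s. indicator {0<..<L} s * g s)"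
  have [measurable]: "k' \<in> borel_measurable lborel" 
    unfolding k'_def by measurable
  have hk': "AE s in lborel. h s = k' s"
    using gh by eventually_elim (auto simp: h_def k'_def split: split_indicator)
  then have "AE s in lebesgue. h s = k' s"
    by (rule AE_completion)
  moreover have "k' \<in> borel_measurable lebesgue"
    by (rule measurable_completion) measurable
  ultimately have "integrable lebesgue k'"
    using h integrable_cong_AE[of h lebesgue k'] borel_measurable_integrable[OF h] by blast
  then have 1: "integrable lborel k'"
    by (subst (asm) integrable_completion) measurable
  have "AE s in lebesgue. s \<notin> {s \<in> {0<..<L}. k s \<noteq> k' s}"
    using \<open>AE s in lebesgue. h s = k' s\<close> by eventually_elim (auto simp: h_def)
  then obtain N where "N \<in> null_sets lebesgue" "{s \<in> {0<..<L}. k s \<noteq> k' s} \<subseteq> N"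
    unfolding eventually_ae_filter by auto
  then have "negligible {s \<in> {0<..<L}. k s \<noteq> k' s}"
    using negligible_iff_null_sets negligible_subset by blast
  then show ?thesis
    using 1 that[of k'] by (auto simp: k'_def)
qed

text \<open>The sign \<open>\<sigma> = -1\<close> gives the left-sided integral over \<open>[a\<^sub>i, t\<^sub>i]\<close>, and \<open>\<sigma> = 1\<close> the right-sided one.\<close>

lemma kernel_integral_eq_line_conv:
  fixes f :: "real^'n \<Rightarrow> real"
  assumes k': "integrable lborel k'" "\<forall>s. s \<notin> {0<..<b $ i - a $ i} \<longrightarrow> k' s = 0"
    "negligible {s \<in> {0<..<b $ i - a $ i}. k s \<noteq> k' s}"
    and f: "continuous_on (cbox a b) f" and t: "t \<in> cbox a b" and \<sigma>: "\<sigma> = 1 \<or> \<sigma> = -1"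
  shows "integral {\<tau> \<in> {a $ i..b $ i}. 0 \<le> \<sigma> * (\<tau> - t $ i)} (\<lambda>\<tau>. k (\<sigma> * (\<tau> - t $ i)) * f (vupd t i \<tau>))
    = line_conv k' \<sigma> i (zero_ext a b f) t"
proof -
  \<comment> \<open>The end points join the exceptional set because \<open>k'\<close> is 0 there
    while nothing is known about \<open>k\<close>.\<close>
  define N where "N = {s \<in> {0<..<b $ i - a $ i}. k s \<noteq> k' s} \<union> {0, b $ i - a $ i}"
  define S where "S = {\<tau> \<in> {a $ i..b $ i}. 0 \<le> \<sigma> * (\<tau> - t $ i)}"
  let ?h = "\<lambda>s. k' s * zero_ext a b f (t + (\<sigma> * s) *\<^sub>R axis i 1)"
  have "negligible N" using k'(3) by (simp add: N_def)
  then have N: "negligible ((\<lambda>s. t $ i + \<sigma> * s) ` N)"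
    by (intro negligible_differentiable_image_negligible) (auto intro!: derivative_intros)
  obtain M where "\<And>x. \<bar>zero_ext a b f x\<bar> \<le> M"
    using zero_ext_bounded[OF f] by metis
  then have h: "integrable lborel ?h"
    by (intro line_conv_integrable k' zero_ext_measurable f)
  \<comment> \<open>As \<sigma> is 1 or -1, the substitution
    \<open>s = \<sigma> * (\<tau> - t $ i)\<close> preserves Lebesgue measure and has the inverse
    \<open>\<tau> = t $ i + \<sigma> * s\<close>.\<close>
  have "integrable lborel (\<lambda>\<tau>. ?h (- \<sigma> * t $ i + \<sigma> * \<tau>))"
    using \<sigma> by (intro lborel_integrable_real_affine h) auto
  from has_integral_integral_lborel[OF this]
  have "((\<lambda>\<tau>. ?h (- \<sigma> * t $ i + \<sigma> * \<tau>)) has_integral line_conv k' \<sigma> i (zero_ext a b f) t) UNIV"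
    unfolding line_conv_def using \<sigma> by (subst lborel_integral_real_affine[where c=\<sigma> and t="- \<sigma> * t $ i"]) auto
  then have "((\<lambda>\<tau>. if \<tau> \<in> S then k (\<sigma> * (\<tau> - t $ i)) * f (vupd t i \<tau>) else 0) has_integral
      line_conv k' \<sigma> i (zero_ext a b f) t) UNIV"
  proof (rule has_integral_spike[OF N, rotated])
    fix \<tau> assume \<tau>: "\<tau> \<in> UNIV - (\<lambda>s. t $ i + \<sigma> * s) ` N"
    define s where "s = \<sigma> * (\<tau> - t $ i)"
    have \<tau>s: "\<tau> = t $ i + \<sigma> * s" "\<sigma> * s = \<tau> - t $ i" "- \<sigma> * t $ i + \<sigma> * \<tau> = s"
      using \<sigma> by (auto simp: s_def algebra_simps)
    have "s \<notin> N" using \<tau> \<tau>s(1) by blast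
    have z: "zero_ext a b f (t + (\<sigma> * s) *\<^sub>R axis i 1) = (if \<tau> \<in> {a $ i..b $ i} then f (vupd t i \<tau>) else 0)"
      using vupd_in_cbox_iff[OF t, of i \<tau>] by (simp add: zero_ext_def \<tau>s(2) vupd_eq_add_axis)
    have "(if \<tau> \<in> S then k s * f (vupd t i \<tau>) else 0) = ?h s"
    proof (cases "\<tau> \<in> S")
      case True
      then have "0 \<le> s" "s \<le> b $ i - a $ i"
        using \<sigma> nth_in_interval[OF t, of i] by (auto simp: S_def s_def)
      with \<open>s \<notin> N\<close> have "k s = k' s" by (auto simp: N_def)
      then show ?thesis using True z by (simp add: S_def)
    next
      case False
      \<comment> \<open>Outside \<open>S\<close> either the point has left the box and the zero
        extension vanishes, or \<open>s\<close> is negative and the kernel does.\<close>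
      then have "\<tau> \<notin> {a $ i..b $ i} \<or> s < 0" by (auto simp: S_def s_def)
      then have "?h s = 0" using z k'(2)[rule_format, of s] by auto
      then show ?thesis using False by simp
    qed
    then show "(if \<tau> \<in> S then k (\<sigma> * (\<tau> - t $ i)) * f (vupd t i \<tau>) else 0) = ?h (- \<sigma> * t $ i + \<sigma> * \<tau>)"
      unfolding \<tau>s(3) unfolding s_def .
  qed
  then have "((\<lambda>\<tau>. k (\<sigma> * (\<tau> - t $ i)) * f (vupd t i \<tau>)) has_integral line_conv k' \<sigma> i (zero_ext a b f) t) S"
    by (simp add: has_integral_restrict_UNIV)
  then show ?thesis by (simp add: S_def integral_unique)
qed

lemma Kop_eq_line_conv:
  fixes f :: "real^'n \<Rightarrow> real"
  assumes k': "integrable lborel k'" "\<forall>s. s \<notin> {0<..<b $ i - a $ i} \<longrightarrow> k' s = 0"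
    "negligible {s \<in> {0<..<b $ i - a $ i}. kern \<gamma> s \<noteq> k' s}"
    and f: "continuous_on (cbox a b) f" and t: "t \<in> cbox a b"
  shows "Kop kern \<gamma> a b p q i f t =
    p * line_conv k' (-1) i (zero_ext a b f) t + q * line_conv k' 1 i (zero_ext a b f) t"
proof -
  have "{\<tau> \<in> {a $ i..b $ i}. 0 \<le> -1 * (\<tau> - t $ i)} = {a $ i..t $ i}"
    "{\<tau> \<in> {a $ i..b $ i}. 0 \<le> 1 * (\<tau> - t $ i)} = {t $ i..b $ i}"
    using nth_in_interval[OF t, of i] by auto
  with kernel_integral_eq_line_conv[OF k' f t, of "-1"] kernel_integral_eq_line_conv[OF k' f t, of 1]
  show ?thesis by (simp add: Kop_def)
qed

section \<open>Bump functions and integration by parts\<close>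

definition bump :: "real^'n \<Rightarrow> real \<Rightarrow> real^'n \<Rightarrow> real" where
  "bump c r x = (max 0 (r\<^sup>2 - (norm (x - c))\<^sup>2))\<^sup>2"

text \<open>The chain rule gives the factor 2 from the outer square and
  \<open>- 2 * (x $ i - c $ i)\<close> from the squared norm.\<close>

definition bump_pd :: "real^'n \<Rightarrow> real \<Rightarrow> 'n \<Rightarrow> real^'n \<Rightarrow> real" where
  "bump_pd c r i x = - 4 * (x $ i - c $ i) * max 0 (r\<^sup>2 - (norm (x - c))\<^sup>2)"

text \<open>At 0, the one point where the two branches meet, the difference quotient is bounded by
  \<open>\<bar>h\<bar>\<close>.\<close>

lemma has_real_derivative_max_0_square:
  "((\<lambda>y::real. (max 0 y)\<^sup>2) has_real_derivative 2 * max 0 y) (at y)"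
proof -
  consider "y > 0" | "y < 0" | "y = 0" by linarith
  then show ?thesis
  proof cases
    case 1
    have "((\<lambda>y. y\<^sup>2) has_real_derivative 2 * y) (at y)"
      by (auto intro!: derivative_eq_intros)
    then have "((\<lambda>y. (max 0 y)\<^sup>2) has_real_derivative 2 * y) (at y)"
      by (rule has_field_derivative_transform_within_open[of _ _ _ "{0<..}"]) (use 1 in auto)
    then show ?thesis using 1 by simp
  next
    case 2
    have "((\<lambda>y. 0) has_real_derivative 0) (at y)" by simp
    then have "((\<lambda>y. (max 0 y)\<^sup>2) has_real_derivative 0) (at y)"
      by (rule has_field_derivative_transform_within_open[of _ _ _ "{..<0}"]) (use 2 in auto)
    then show ?thesis using 2 by simp
  next
    case 3
    have "((\<lambda>h::real. (max 0 h)\<^sup>2 / h) \<longlongrightarrow> 0) (at 0)"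
    proof (rule Lim_null_comparison)
      have "norm ((max 0 h)\<^sup>2 / h) \<le> \<bar>h\<bar>" for h :: real
        by (auto simp: max_def power2_eq_square)
      then show "\<forall>\<^sub>F h::real in at 0. norm ((max 0 h)\<^sup>2 / h) \<le> \<bar>h\<bar>" by simp
      show "((\<lambda>h::real. \<bar>h\<bar>) \<longlongrightarrow> 0) (at 0)"
        by (rule tendsto_eq_intros refl)+ simp
    qed
    then show ?thesis using 3 by (simp add: has_field_derivative_iff)
  qed
qed

text \<open>Only the i-th summand of the squared distance changes along the line, so the bump
  restricted to it is the squared positive part of a quadratic polynomial in
  \<open>s\<close>.\<close>

lemma norm_vupd_diff_square:
  "(norm (vupd x i s - c))\<^sup>2 = (norm (x - c))\<^sup>2 - (x $ i - c $ i)\<^sup>2 + (s - c $ i)\<^sup>2"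
proof -
  have "vupd x i s - c = (x - c) + (s - x $ i) *\<^sub>R axis i 1"
    by (simp add: vupd_eq_add_axis)
  then show ?thesis
    by (simp only: power2_norm_eq_inner)
       (simp add: inner_add_left inner_add_right inner_axis inner_commute[of "axis i 1"]
         power2_eq_square algebra_simps)
qed

lemma bump_has_real_derivative:
  "((\<lambda>s. bump c r (vupd x i s)) has_real_derivative bump_pd c r i (vupd x i s)) (at s)"
proof -
  have "((\<lambda>s. r\<^sup>2 - (norm (vupd x i s - c))\<^sup>2) has_real_derivative - 2 * (s - c $ i)) (at s)"
    unfolding norm_vupd_diff_square by (auto intro!: derivative_eq_intros)
  from DERIV_chain2[OF has_real_derivative_max_0_square this]
  show ?thesis by (simp add: bump_def bump_pd_def algebra_simps)
qed

lemma continuous_on_bump: "continuous_on S (bump c r)"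
  unfolding bump_def by (intro continuous_intros)

lemma continuous_on_bump_pd: "continuous_on S (bump_pd c r i)"
  unfolding bump_pd_def by (intro continuous_intros)

lemma bump_nonneg: "0 \<le> bump c r x"
  by (simp add: bump_def)

lemma bump_center_pos: "r > 0 \<Longrightarrow> 0 < bump c r c"
  by (simp add: bump_def)

lemma bump_outside:
  assumes "r > 0" "x \<notin> ball c r"
  shows "bump c r x = 0" "bump_pd c r i x = 0"
proof -
  have "r \<le> norm (x - c)" using assms by (simp add: dist_norm norm_minus_commute)
  then have "r\<^sup>2 \<le> (norm (x - c))\<^sup>2" using assms(1) by (intro power_mono) auto
  then show "bump c r x = 0" "bump_pd c r i x = 0" by (simp_all add: bump_def bump_pd_def)
qed

lemma pd_bump:
  assumes "a $ i < b $ i" "t \<in> cbox a b"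
  shows "pd a b i (bump c r) t = bump_pd c r i t"
  using assms bump_has_real_derivative[of c r t i "t $ i"]
  by (intro has_vector_derivative_imp_pd_eq)
     (auto simp: has_real_derivative_iff_has_vector_derivative intro: has_vector_derivative_at_within)

lemma C1cl_bump:
  assumes "\<forall>i. a $ i < b $ i"
  shows "C1cl a b (bump c r)"
  unfolding C1cl_def
proof (intro conjI allI ballI)
  show "continuous_on (cbox a b) (bump c r)" by (rule continuous_on_bump)
  show "(\<lambda>s. bump c r (vupd t i s)) differentiable at (t $ i) within {a $ i..b $ i}" for i t
    using bump_has_real_derivative[of c r t i "t $ i"]
    by (meson differentiable_at_withinI real_differentiable_def)
  show "continuous_on (cbox a b) (pd a b i (bump c r))" for i
    using assms continuous_on_bump_pd by (subst continuous_on_cong[OF refl pd_bump]) auto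
qed

text \<open>Since \<open>bump_pd\<close> vanishes off the ball, extension by zero creates no jump
  here; the result is continuous on the whole space, as \<open>continuous_on_line_conv\<close>
  demands.\<close>

lemma zero_ext_pd_bump:
  assumes "a $ i < b $ i" "r > 0" "ball c r \<subseteq> cbox a b"
  shows "zero_ext a b (pd a b i (bump c r)) = bump_pd c r i"
proof
  fix x
  show "zero_ext a b (pd a b i (bump c r)) x = bump_pd c r i x"
    using assms bump_outside(2)[of r x c i] pd_bump[of a i b x c r]
    by (cases "x \<in> cbox a b") (auto simp: zero_ext_def subset_iff)
qed

lemma bump_pd_bounded:
  assumes "r > 0"
  obtains M where "\<And>x. \<bar>bump_pd c r i x\<bar> \<le> M"
proof -
  have "bounded (bump_pd c r i ` cball c r)"
    by (intro compact_imp_bounded compact_continuous_image compact_cball continuous_on_bump_pd)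
  then obtain M where M: "M > 0" "\<And>x. x \<in> cball c r \<Longrightarrow> \<bar>bump_pd c r i x\<bar> \<le> M"
    unfolding bounded_pos by auto
  have "\<bar>bump_pd c r i x\<bar> \<le> M" for x
    using M bump_outside(2)[OF assms, of x c i] by (cases "x \<in> ball c r") auto
  with that show ?thesis by blast
qed

text \<open>Translation invariance makes the integral of every difference quotient vanish.\<close>

lemma lborel_integral_directional_derivative:
  fixes W W' :: "'a::euclidean_space \<Rightarrow> real"
  assumes W: "integrable lborel W"
    and der: "\<And>x. ((\<lambda>s. W (x + s *\<^sub>R e)) has_real_derivative W' x) (at 0)"
    and M: "\<And>x. \<bar>W' x\<bar> \<le> M"
    and supp: "\<And>x. R < norm x \<Longrightarrow> W x = 0"
  shows "(LINT x|lborel. W' x) = 0"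
proof -
  \<comment> \<open>Steps of length at most 1 keep the supports of all difference quotients in the
    ball of radius \<open>R + norm e\<close>.\<close>
  define h where "h = (\<lambda>n. 1 / real (Suc n))"
  have h: "h n > 0" "h n \<le> 1" for n by (auto simp: h_def)
  have h0: "h \<longlonglongrightarrow> 0" unfolding h_def using LIMSEQ_inverse_real_of_nat by (simp add: inverse_eq_divide)
  note [measurable] = borel_measurable_integrable[OF W]
  have Wc: "integrable lborel (\<lambda>x. W (x + c))" for c
    using W lborel_distr_plus[of c] integrable_distr[of "(+) c" lborel borel W]
    by (simp add: add.commute)
  define D where "D = (\<lambda>n x. (W (x + h n *\<^sub>R e) - W x) / h n)"
  have D0: "(LINT x|lborel. D n x) = 0" for n
    using Wc[of "h n *\<^sub>R e"] W lborel_integral_translation[of W "h n *\<^sub>R e"] by (simp add: D_def)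
  have D: "(\<lambda>n. D n x) \<longlonglongrightarrow> W' x" for x
  proof -
    have "((\<lambda>s. (W (x + s *\<^sub>R e) - W x) / s) \<longlongrightarrow> W' x) (at 0)"
      using der[of x] by (simp add: has_field_derivative_iff)
    moreover have "filterlim h (at 0) sequentially"
      unfolding filterlim_at using h0 by (simp add: h_def)
    ultimately show ?thesis unfolding D_def by (rule filterlim_compose)
  qed
  have Dbound: "\<bar>D n x\<bar> \<le> M * indicator (cball 0 (R + norm e)) x" for n x
  proof (cases "x \<in> cball 0 (R + norm e)")
    case True
    \<comment> \<open>The hypothesis speaks of parameter 0 but of every base point; restarting the
      line at \<open>x + s *\<^sub>R e\<close> gives the derivative at \<open>s\<close>, as the mean
      value theorem needs.\<close>
    have "((\<lambda>s. W (x + s *\<^sub>R e)) has_real_derivative W' (x + s *\<^sub>R e)) (at s)" for s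
      using der[of "x + s *\<^sub>R e"] DERIV_shift[of "\<lambda>s. W (x + s *\<^sub>R e)" "W' (x + s *\<^sub>R e)" 0 s]
      by (simp add: scaleR_left_distrib add_ac)
    from MVT2[OF h(1), OF this] obtain z where "W (x + h n *\<^sub>R e) - W x = h n * W' (x + z *\<^sub>R e)"
      by fastforce
    then have "D n x = W' (x + z *\<^sub>R e)" using h[of n] by (simp add: D_def)
    then show ?thesis using True M by simp
  next
    case False
    then have "norm x > R + norm e" by simp
    moreover have "norm (h n *\<^sub>R e) \<le> norm e" using h[of n] by (simp add: mult_left_le_one_le)
    moreover have "norm x \<le> norm (x + h n *\<^sub>R e) + norm (h n *\<^sub>R e)"
      by (metis add_diff_cancel_right' norm_triangle_ineq4)
    moreover have "norm e \<ge> 0" by simp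
    ultimately have "W x = 0" "W (x + h n *\<^sub>R e) = 0" by (intro supp; linarith)+
    then show ?thesis using False by (simp add: D_def)
  qed
  have "(\<lambda>n. LINT x|lborel. D n x) \<longlonglongrightarrow> (LINT x|lborel. W' x)"
  proof (rule integral_dominated_convergence)
    show [measurable]: "D n \<in> borel_measurable lborel" for n unfolding D_def by measurable
    \<comment> \<open>The derivative is given only pointwise; it is measurable as a limit of the
      quotients \<open>D n\<close>.\<close>
    show "W' \<in> borel_measurable lborel"
      using D by (rule borel_measurable_LIMSEQ_real) measurable
    show "integrable lborel (\<lambda>x. M * indicator (cball 0 (R + norm e)) x)"
      by (intro integrable_mult_right) (auto intro!: integrable_real_indicator emeasure_bounded_finite)
    show "AE x in lborel. (\<lambda>n. D n x) \<longlonglongrightarrow> W' x" by (rule AE_I2) (rule D)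
    show "AE x in lborel. norm (D n x) \<le> M * indicator (cball 0 (R + norm e)) x" for n
      by (rule AE_I2) (simp only: real_norm_def Dbound)
  qed
  then show ?thesis by (simp only: D0 LIMSEQ_const_iff)
qed

text \<open>The product of \<open>H\<close> and the bump, extended by zero, is differentiable along
  the axis at every point of space, so the integral of its derivative is 0; the product rule splits
  that integral.\<close>

lemma integral_by_parts_bump:
  fixes H :: "real^'n \<Rightarrow> real"
  assumes ab: "\<forall>i. a $ i < b $ i" and H: "C1cl a b H" and r: "r > 0" "cball c r \<subseteq> box a b"
  shows "integral (cbox a b) (\<lambda>t. H t * bump_pd c r i t) = - integral (cbox a b) (\<lambda>t. pd a b i H t * bump c r t)"
proof -
  let ?f = "\<lambda>t. H t * bump c r t"
  let ?f' = "\<lambda>t. H t * bump_pd c r i t + pd a b i H t * bump c r t"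
  have cH: "continuous_on (cbox a b) H" "continuous_on (cbox a b) (pd a b i H)"
    using H by (auto simp: C1cl_def)
  have c1: "continuous_on (cbox a b) (\<lambda>t. H t * bump_pd c r i t)"
    and c2: "continuous_on (cbox a b) (\<lambda>t. pd a b i H t * bump c r t)"
    and cf: "continuous_on (cbox a b) ?f"
    by (intro continuous_intros cH continuous_on_bump continuous_on_bump_pd)+
  have cf': "continuous_on (cbox a b) ?f'"
    using c1 c2 by (rule continuous_on_add)
  obtain M where M: "\<And>x. \<bar>zero_ext a b ?f' x\<bar> \<le> M"
    using zero_ext_bounded[OF cf'] by metis
  obtain R where R: "\<And>x. x \<in> cbox a b \<Longrightarrow> norm x \<le> R"
    using bounded_cbox[of a b] unfolding bounded_iff by blast
  have "(LINT x|lborel. zero_ext a b ?f' x) = 0"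
  proof (rule lborel_integral_directional_derivative[where e = "axis i 1" and M = M and R = R])
    show "integrable lborel (zero_ext a b ?f)" using cf by (rule zero_ext_integrable)
    show "\<bar>zero_ext a b ?f' x\<bar> \<le> M" for x by (rule M)
    show "zero_ext a b ?f x = 0" if "R < norm x" for x
      using that R[of x] by (auto simp: zero_ext_def split: split_indicator)
    show "((\<lambda>s. zero_ext a b ?f (x + s *\<^sub>R axis i 1)) has_real_derivative zero_ext a b ?f' x) (at 0)" for x
    proof (cases "x \<in> box a b")
      case True
      then have x: "x \<in> cbox a b" using box_subset_cbox by blast
      have xi: "x $ i \<in> {a $ i<..<b $ i}" using True by (auto simp: mem_box_cart)
      have "((\<lambda>s. H (vupd x i s)) has_real_derivative pd a b i H x) (at (x $ i) within {a $ i..b $ i})"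
        using C1cl_has_vector_derivative_pd[OF H x, of i]
        by (simp add: has_real_derivative_iff_has_vector_derivative)
      then have "((\<lambda>s. H (vupd x i s)) has_real_derivative pd a b i H x) (at (x $ i))"
        using xi at_within_Icc_at[of "a $ i" "x $ i" "b $ i"] by simp
      from DERIV_mult[OF this bump_has_real_derivative[of c r x i "x $ i"]]
      have "((\<lambda>s. ?f (vupd x i s)) has_real_derivative ?f' x) (at (x $ i))"
        by (simp add: algebra_simps)
      then have "((\<lambda>s. zero_ext a b ?f (vupd x i s)) has_real_derivative ?f' x) (at (x $ i))"
        by (rule has_field_derivative_transform_within_open[of _ _ _ "{a $ i<..<b $ i}"])
           (use xi x in \<open>auto simp: zero_ext_def vupd_in_cbox_iff split: split_indicator\<close>)
      then show ?thesis
        using x DERIV_shift[of "\<lambda>s. zero_ext a b ?f (vupd x i s)" "?f' x" 0 "x $ i"]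
        by (simp add: zero_ext_def vupd_eq_add_axis)
    next
      case False
      \<comment> \<open>Off the open box the point has a neighbourhood missing the closed ball, so
        the product is locally zero although \<open>H\<close> has only one-sided derivatives at the
        faces.\<close>
      then have x: "x \<in> - cball c r" using r by auto
      let ?U = "(\<lambda>s::real. x + s *\<^sub>R axis i 1) -` (- cball c r)"
      have U: "open ?U"
        by (intro open_vimage continuous_intros) auto
      have 0: "0 = zero_ext a b ?f y" if "y \<notin> cball c r" for y
        using that bump_outside(1)[OF r(1), of y c] by (simp add: zero_ext_def)
      have "((\<lambda>s. zero_ext a b ?f (x + s *\<^sub>R axis i 1)) has_real_derivative 0) (at 0)"
      proof (rule has_field_derivative_transform_within_open[OF DERIV_const U])
        show "0 \<in> ?U" using x by simp
        show "0 = zero_ext a b ?f (x + s *\<^sub>R axis i 1)" if "s \<in> ?U" for s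
          using that by (intro 0) blast
      qed
      then show ?thesis
        using x bump_outside[OF r(1), of x c] by (simp add: zero_ext_def)
    qed
  qed
  then have "integral (cbox a b) ?f' = 0"
    using integral_cbox_eq_lborel[OF cf'] by simp
  then show ?thesis
    using Henstock_Kurzweil_Integration.integral_add[OF integrable_continuous[OF c1] integrable_continuous[OF c2]]
    by linarith
qed

section \<open>The fractional operators on bumps: continuity, linearity, duality\<close>

lemma continuous_on_Kop_pd_bump:
  fixes a b :: "real^'n"
  assumes ab: "\<forall>i. a $ i < b $ i" and k: "kern \<gamma> absolutely_integrable_on {0<..<b $ i - a $ i}"
    and r: "r > 0" "cball c r \<subseteq> box a b"
  shows "continuous_on (cbox a b) (Kop kern \<gamma> a b p q i (pd a b i (bump c r)))"
proof -
  obtain k' where k': "integrable lborel k'" "\<forall>s. s \<notin> {0<..<b $ i - a $ i} \<longrightarrow> k' s = 0"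
    "negligible {s \<in> {0<..<b $ i - a $ i}. kern \<gamma> s \<noteq> k' s}"
    using absolutely_integrable_Borel_version[OF k] by metis
  have sub: "ball c r \<subseteq> cbox a b" using r ball_subset_cball box_subset_cbox by blast
  obtain M where M: "\<And>x. \<bar>bump_pd c r i x\<bar> \<le> M" using bump_pd_bounded[OF r(1)] by metis
  have "continuous_on (cbox a b) (\<lambda>t. p * line_conv k' (-1) i (bump_pd c r i) t + q * line_conv k' 1 i (bump_pd c r i) t)"
    by (intro continuous_intros continuous_on_line_conv[OF k'(1) continuous_on_bump_pd M])
  moreover have "Kop kern \<gamma> a b p q i (pd a b i (bump c r)) t =
      p * line_conv k' (-1) i (bump_pd c r i) t + q * line_conv k' 1 i (bump_pd c r i) t"
    if "t \<in> cbox a b" for t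
    using Kop_eq_line_conv[where kern=kern and \<gamma>=\<gamma>, OF k' _ that] C1cl_bump[OF ab, of c r] ab zero_ext_pd_bump[OF _ r(1) sub]
    by (simp add: C1cl_def)
  ultimately show ?thesis by (simp cong: continuous_on_cong)
qed

text \<open>Splitting the integral requires integrability of each summand, which the convolution
  form supplies through the boundedness of continuous functions on the box.\<close>

lemma Kop_add_scaled:
  fixes f g :: "real^'n \<Rightarrow> real"
  assumes k: "kern \<gamma> absolutely_integrable_on {0<..<b $ i - a $ i}"
    and "continuous_on (cbox a b) f" "continuous_on (cbox a b) g" "t \<in> cbox a b"
  shows "Kop kern \<gamma> a b p q i (\<lambda>x. f x + c * g x) t = Kop kern \<gamma> a b p q i f t + c * Kop kern \<gamma> a b p q i g t"
proof -
  obtain k' where k': "integrable lborel k'" "\<forall>s. s \<notin> {0<..<b $ i - a $ i} \<longrightarrow> k' s = 0"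
    "negligible {s \<in> {0<..<b $ i - a $ i}. kern \<gamma> s \<noteq> k' s}"
    using absolutely_integrable_Borel_version[OF k] by metis
  have fg: "continuous_on (cbox a b) (\<lambda>x. f x + c * g x)"
    using assms by (intro continuous_intros)
  note K = Kop_eq_line_conv[where kern=kern and \<gamma>=\<gamma>, OF k' _ assms(4)]
  show ?thesis
    unfolding K[OF fg] K[OF assms(2)] K[OF assms(3)] line_conv_add_scaled[OF k'(1) assms(2,3)]
    by (simp add: algebra_simps)
qed

lemma Bop_add_scaled:
  fixes f g :: "real^'n \<Rightarrow> real"
  assumes ab: "\<forall>i. a $ i < b $ i"
    and k: "kern (1 - \<alpha>) absolutely_integrable_on {0<..<b $ i - a $ i}"
    and f: "C1cl a b f" and g: "C1cl a b g" and t: "t \<in> cbox a b"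
  shows "Bop kern \<alpha> a b p q i (\<lambda>x. f x + c * g x) t = Bop kern \<alpha> a b p q i f t + c * Bop kern \<alpha> a b p q i g t"
proof -
  have ti: "a $ i \<le> t $ i" "t $ i \<le> b $ i" using nth_in_interval[OF t, of i] by auto
  have "Kop kern (1 - \<alpha>) a b p q i (pd a b i (\<lambda>x. f x + c * g x)) t =
      Kop kern (1 - \<alpha>) a b p q i (\<lambda>x. pd a b i f x + c * pd a b i g x) t"
  proof -
    \<comment> \<open>Additivity of \<open>pd\<close> is known on the closed box only, and the
      integrals in \<open>Kop\<close> evaluate it only there.\<close>
    have "pd a b i (\<lambda>x. f x + c * g x) (vupd t i \<tau>) = pd a b i f (vupd t i \<tau>) + c * pd a b i g (vupd t i \<tau>)"
      if "\<tau> \<in> {a $ i..b $ i}" for \<tau>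
      using ab f g vupd_in_cbox_iff[OF t, of i \<tau>] that by (intro pd_add_scaled) auto
    then show ?thesis
      unfolding Kop_def using ti
      by (intro arg_cong2[of _ _ _ _ "(+)"] arg_cong2[of _ _ _ _ "(*)"] refl integral_cong) auto
  qed
  also have "\<dots> = Kop kern (1 - \<alpha>) a b p q i (pd a b i f) t + c * Kop kern (1 - \<alpha>) a b p q i (pd a b i g) t"
    using f g by (intro Kop_add_scaled k t) (auto simp: C1cl_def)
  finally show ?thesis by (simp add: Bop_def)
qed

text \<open>The adjoint exchanges the directions 1 and -1, so the weights \<open>p\<close> and
  \<open>q\<close> trade places and the dual operator appears. The classical integration by parts is
  then applied to the dual operator's value, which is the function assumed to be C^1, and not to
  \<open>g\<close>.\<close>

lemma integral_Kop_by_parts_bump: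
  fixes g :: "real^'n \<Rightarrow> real"
  assumes ab: "\<forall>i. a $ i < b $ i" and k: "kern \<gamma> absolutely_integrable_on {0<..<b $ i - a $ i}"
    and r: "r > 0" "cball c r \<subseteq> box a b" and g: "continuous_on (cbox a b) g"
    and H: "C1cl a b (Kop kern \<gamma> a b q p i g)"
  shows "integral (cbox a b) (\<lambda>t. g t * Kop kern \<gamma> a b p q i (pd a b i (bump c r)) t) =
    - integral (cbox a b) (\<lambda>t. pd a b i (Kop kern \<gamma> a b q p i g) t * bump c r t)"
proof -
  obtain k' where k': "integrable lborel k'" "\<forall>s. s \<notin> {0<..<b $ i - a $ i} \<longrightarrow> k' s = 0"
    "negligible {s \<in> {0<..<b $ i - a $ i}. kern \<gamma> s \<noteq> k' s}"
    using absolutely_integrable_Borel_version[OF k] by metis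
  let ?\<phi> = "bump_pd c r i" and ?g = "zero_ext a b g"
  have sub: "ball c r \<subseteq> cbox a b" using r ball_subset_cball box_subset_cbox by blast
  obtain M where M: "\<And>x. \<bar>?\<phi> x\<bar> \<le> M" using bump_pd_bounded[OF r(1)] by metis
  have \<phi>: "?\<phi> \<in> borel_measurable borel"
    by (intro borel_measurable_continuous_onI continuous_on_bump_pd)
  have gi: "integrable lborel ?g" using g by (rule zero_ext_integrable)
  obtain Mg where Mg: "\<And>x. \<bar>?g x\<bar> \<le> Mg" using zero_ext_bounded[OF g] by metis
  have adj: "(LINT t|lborel. ?g t * line_conv k' \<sigma> i ?\<phi> t) = (LINT t|lborel. line_conv k' (- \<sigma>) i ?g t * ?\<phi> t)" for \<sigma>
    by (rule line_conv_adjoint[OF k'(1) gi \<phi> M])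
  have K\<phi>: "Kop kern \<gamma> a b p q i (pd a b i (bump c r)) t =
      p * line_conv k' (-1) i ?\<phi> t + q * line_conv k' 1 i ?\<phi> t" if "t \<in> cbox a b" for t
    using Kop_eq_line_conv[where kern=kern and \<gamma>=\<gamma>, OF k' _ that] C1cl_bump[OF ab, of c r] ab zero_ext_pd_bump[OF _ r(1) sub]
    by (simp add: C1cl_def)
  have Kg: "Kop kern \<gamma> a b q p i g t = q * line_conv k' (-1) i ?g t + p * line_conv k' 1 i ?g t"
    if "t \<in> cbox a b" for t
    by (rule Kop_eq_line_conv[where kern=kern and \<gamma>=\<gamma>, OF k' g that])
  have int1: "integrable lborel (\<lambda>t. ?g t * line_conv k' \<sigma> i ?\<phi> t)" for \<sigma>
  proof -
    have "continuous_on (cbox a b) (\<lambda>t. g t * line_conv k' \<sigma> i ?\<phi> t)"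
      by (intro continuous_intros g continuous_on_line_conv[OF k'(1) continuous_on_bump_pd M])
    from zero_ext_integrable[OF this] show ?thesis by (simp add: zero_ext_def[abs_def] mult.assoc)
  qed
  \<comment> \<open>Because \<open>?g\<close> may jump at the boundary, its one-sided convolutions
    are not known to be continuous; they are bounded by the L^1 norm of \<open>k'\<close> times
    \<open>Mg\<close>, and \<open>?\<phi>\<close> is integrable.\<close>
  have int2: "integrable lborel (\<lambda>t. line_conv k' \<sigma> i ?g t * ?\<phi> t)" for \<sigma>
  proof (rule Bochner_Integration.integrable_bound)
    let ?C = "LINT s|lborel. \<bar>k' s\<bar> * Mg"
    have "integrable lborel (zero_ext a b ?\<phi>)"
      by (intro zero_ext_integrable continuous_on_bump_pd)
    moreover have "zero_ext a b ?\<phi> = ?\<phi>"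
      using bump_outside(2)[OF r(1), of _ c i] sub by (fastforce simp: zero_ext_def fun_eq_iff split: split_indicator)
    ultimately show "integrable lborel (\<lambda>t. ?C * ?\<phi> t)" by simp
    note [measurable] = borel_measurable_integrable[OF k'(1)] zero_ext_measurable[OF g] \<phi>
    show "(\<lambda>t. line_conv k' \<sigma> i ?g t * ?\<phi> t) \<in> borel_measurable lborel"
      unfolding line_conv_def by measurable
    have "\<bar>line_conv k' \<sigma> i ?g t\<bar> \<le> ?C" for t
    proof -
      have "norm (line_conv k' \<sigma> i ?g t) \<le> ?C" unfolding line_conv_def
        using k'(1) Mg
        by (intro Bochner_Integration.integral_norm_bound_integral line_conv_integrable[OF k'(1) zero_ext_measurable[OF g] Mg])
           (auto simp: abs_mult intro!: mult_left_mono)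
      then show ?thesis by simp
    qed
    then have "\<bar>line_conv k' \<sigma> i ?g t\<bar> * \<bar>?\<phi> t\<bar> \<le> \<bar>?C\<bar> * \<bar>?\<phi> t\<bar>" for t
      by (intro mult_right_mono order_trans[OF _ abs_ge_self[of ?C]] abs_ge_zero)
    then show "AE t in lborel. norm (line_conv k' \<sigma> i ?g t * ?\<phi> t) \<le> norm (?C * ?\<phi> t)"
      by (intro AE_I2) (simp only: real_norm_def abs_mult)
  qed
  have cH: "continuous_on (cbox a b) (Kop kern \<gamma> a b q p i g)" using H by (simp add: C1cl_def)
  have "integral (cbox a b) (\<lambda>t. g t * Kop kern \<gamma> a b p q i (pd a b i (bump c r)) t) =
      (LINT t|lborel. zero_ext a b (\<lambda>t. g t * Kop kern \<gamma> a b p q i (pd a b i (bump c r)) t) t)"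
    by (intro integral_cbox_eq_lborel continuous_intros g continuous_on_Kop_pd_bump ab k r)
  also have "\<dots> = (LINT t|lborel. p * (?g t * line_conv k' (-1) i ?\<phi> t) + q * (?g t * line_conv k' 1 i ?\<phi> t))"
    using K\<phi> by (intro Bochner_Integration.integral_cong refl)
      (auto simp: zero_ext_def algebra_simps split: split_indicator)
  also have "\<dots> = (LINT t|lborel. p * (line_conv k' 1 i ?g t * ?\<phi> t) + q * (line_conv k' (-1) i ?g t * ?\<phi> t))"
    using int1 int2 adj[of 1] adj[of "-1"] by simp
  also have "\<dots> = (LINT t|lborel. zero_ext a b (\<lambda>t. Kop kern \<gamma> a b q p i g t * ?\<phi> t) t)"
  proof (intro Bochner_Integration.integral_cong refl)
    fix t
    show "p * (line_conv k' 1 i ?g t * ?\<phi> t) + q * (line_conv k' (-1) i ?g t * ?\<phi> t) =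
        zero_ext a b (\<lambda>t. Kop kern \<gamma> a b q p i g t * ?\<phi> t) t"
    proof (cases "t \<in> cbox a b")
      case True
      then show ?thesis by (simp add: zero_ext_def Kg algebra_simps)
    next
      case False
      then have "?\<phi> t = 0" using sub by (intro bump_outside(2)[OF r(1)]) blast
      then show ?thesis by (simp add: zero_ext_def)
    qed
  qed
  also have "\<dots> = integral (cbox a b) (\<lambda>t. Kop kern \<gamma> a b q p i g t * ?\<phi> t)"
    by (intro integral_cbox_eq_lborel[symmetric] continuous_intros cH continuous_on_bump_pd)
  also have "\<dots> = - integral (cbox a b) (\<lambda>t. pd a b i (Kop kern \<gamma> a b q p i g) t * bump c r t)"
    by (rule integral_by_parts_bump[OF ab H r])
  finally show ?thesis .
qed

section \<open>The first variation\<close>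

text \<open>The direction has first component 0, so the entire line stays in
  \<open>C \<times> UNIV\<close>. The derivative within this set thus restricts to a two-sided
  derivative in the parameter, even over boundary points of \<open>C\<close>. The offset
  \<open>s0\<close> allows the parameter to be the value of a coordinate instead of an
  increment.\<close>

lemma has_real_derivative_along_line:
  fixes G :: "'a::real_normed_vector \<times> 'b::real_normed_vector \<Rightarrow> real"
  assumes G: "\<forall>z\<in>C \<times> UNIV. (G has_derivative blinfun_apply (G1 z)) (at z within C \<times> UNIV)"
    and z: "fst z \<in> C" "fst d = 0"
  shows "((\<lambda>s. G (z + (s - s0) *\<^sub>R d)) has_real_derivative G1 (z + (s1 - s0) *\<^sub>R d) d) (at s1)"
proof -
  let ?l = "\<lambda>s. z + (s - s0) *\<^sub>R d"
  have l: "range ?l \<subseteq> C \<times> UNIV"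
    using z by (simp add: image_subset_iff mem_Times_iff)
  have "(?l has_derivative (\<lambda>h. h *\<^sub>R d)) (at s1)"
    by (auto intro!: derivative_eq_intros)
  moreover have "(G has_derivative blinfun_apply (G1 (?l s1))) (at (?l s1) within range ?l)"
    using l by (intro has_derivative_subset[OF _ l] bspec[OF G]) blast
  ultimately have "((\<lambda>s. G (?l s)) has_derivative (\<lambda>h. G1 (?l s1) (h *\<^sub>R d))) (at s1)"
    by (rule has_derivative_in_compose)
  then show ?thesis
    by (simp add: has_field_derivative_def blinfun.scaleR_right mult_commute_abs)
qed

text \<open>Differentiation under the integral sign, justified by joint continuity of the derivative
  in \<open>h\<close> and \<open>t\<close>; the zero first component of \<open>D\<close> keeps all
  arguments in the domain of \<open>G\<close>.\<close>

lemma has_real_derivative_first_variation: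
  fixes G :: "'a::euclidean_space \<times> 'b::real_normed_vector \<Rightarrow> real"
  assumes G: "\<forall>z\<in>cbox a b \<times> UNIV. (G has_derivative blinfun_apply (G1 z)) (at z within cbox a b \<times> UNIV)"
    and G1: "continuous_on (cbox a b \<times> UNIV) G1"
    and Z: "continuous_on (cbox a b) Z" "\<And>t. t \<in> cbox a b \<Longrightarrow> fst (Z t) \<in> cbox a b"
    and D: "continuous_on (cbox a b) D" "\<And>t. t \<in> cbox a b \<Longrightarrow> fst (D t) = 0"
  shows "((\<lambda>h. integral (cbox a b) (\<lambda>t. G (Z t + h *\<^sub>R D t))) has_real_derivative
    integral (cbox a b) (\<lambda>t. G1 (Z t) (D t))) (at 0)"
proof -
  have in_S: "Z t + h *\<^sub>R D t \<in> cbox a b \<times> UNIV" if "t \<in> cbox a b" for t h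
    using that Z D by (auto simp: mem_Times_iff)
  have cG: "continuous_on (cbox a b \<times> UNIV) G"
    by (rule has_derivative_continuous_on) (rule G[rule_format])
  have "continuous_on (cbox a b) (\<lambda>t. G (Z t + h *\<^sub>R D t))" for h
  proof (rule continuous_on_compose2[OF cG])
    show "continuous_on (cbox a b) (\<lambda>t. Z t + h *\<^sub>R D t)"
      by (intro continuous_intros Z D)
    show "(\<lambda>t. Z t + h *\<^sub>R D t) ` cbox a b \<subseteq> cbox a b \<times> UNIV"
      using in_S by (rule image_subsetI)
  qed
  then have int: "(\<lambda>t. G (Z t + h *\<^sub>R D t)) integrable_on cbox a b" for h
    by (rule integrable_continuous)
  have ZD: "continuous_on (UNIV \<times> cbox a b) (\<lambda>x. Z (snd x))" "continuous_on (UNIV \<times> cbox a b) (\<lambda>x. D (snd x))"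
    by (rule continuous_on_compose2[OF Z(1)] continuous_on_compose2[OF D(1)];
        auto intro: continuous_intros)+
  have "continuous_on (UNIV \<times> cbox a b) (\<lambda>x. G1 (Z (snd x) + fst x *\<^sub>R D (snd x)))"
  proof (rule continuous_on_compose2[OF G1])
    show "continuous_on (UNIV \<times> cbox a b) (\<lambda>x. Z (snd x) + fst x *\<^sub>R D (snd x))"
      by (intro continuous_intros ZD)
    show "(\<lambda>x. Z (snd x) + fst x *\<^sub>R D (snd x)) ` (UNIV \<times> cbox a b) \<subseteq> cbox a b \<times> UNIV"
      by (rule image_subsetI, rule in_S) (simp add: mem_Times_iff)
  qed
  then have "continuous_on (UNIV \<times> cbox a b) (\<lambda>x. G1 (Z (snd x) + fst x *\<^sub>R D (snd x)) (D (snd x)))"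
    by (intro continuous_intros ZD)
  then have cont: "continuous_on (UNIV \<times> cbox a b) (\<lambda>(h, t). G1 (Z t + h *\<^sub>R D t) (D t))"
    by (simp add: case_prod_unfold)
  have "((\<lambda>h. G (Z t + h *\<^sub>R D t)) has_real_derivative G1 (Z t + h *\<^sub>R D t) (D t)) (at h within UNIV)"
    if "t \<in> cbox a b" for h t
    using has_real_derivative_along_line[OF G, of "Z t" "D t" 0 h] Z D that by simp
  from leibniz_rule_field_derivative[OF this int cont, of 0]
  show ?thesis by simp
qed

section \<open>Partial derivatives of the integrand and perturbation by a bump\<close>

lemma dFx_eq:
  assumes G: "\<forall>z\<in>C \<times> UNIV. ((\<lambda>(t, x, v, w). F t x v w) has_derivative blinfun_apply (G1 z)) (at z within C \<times> UNIV)"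
    and t: "t \<in> C"
  shows "dFx F k t x v w = G1 (t, x, v, w) (0, axis k 1, 0, 0)"
  unfolding dFx_def
  using has_real_derivative_along_line[OF G, of "(t, x, v, w)" "(0, axis k 1, 0, 0)" "x $ k" "x $ k"] t
  by (intro DERIV_imp_deriv) (simp add: vupd_eq_add_axis)

lemma vec_lambda_vupd_row:
  "(\<chi> k'. if k' = k then vupd (v $ k) i s else v $ k') = v + (s - v $ k $ i) *\<^sub>R axis k (axis i 1)"
  by (simp add: vec_eq_iff axis_def)

lemma dFv_eq:
  assumes G: "\<forall>z\<in>C \<times> UNIV. ((\<lambda>(t, x, v, w). F t x v w) has_derivative blinfun_apply (G1 z)) (at z within C \<times> UNIV)"
    and t: "t \<in> C"
  shows "dFv F k i t x v w = G1 (t, x, v, w) (0, 0, axis k (axis i 1), 0)"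
  unfolding dFv_def vec_lambda_vupd_row
  using has_real_derivative_along_line[OF G, of "(t, x, v, w)" "(0, 0, axis k (axis i 1), 0)" "v $ k $ i" "v $ k $ i"] t
  by (intro DERIV_imp_deriv) simp

lemma dFw_eq:
  assumes G: "\<forall>z\<in>C \<times> UNIV. ((\<lambda>(t, x, v, w). F t x v w) has_derivative blinfun_apply (G1 z)) (at z within C \<times> UNIV)"
    and t: "t \<in> C"
  shows "dFw F k i t x v w = G1 (t, x, v, w) (0, 0, 0, axis k (axis i 1))"
  unfolding dFw_def vec_lambda_vupd_row
  using has_real_derivative_along_line[OF G, of "(t, x, v, w)" "(0, 0, 0, axis k (axis i 1))" "w $ k $ i" "w $ k $ i"] t
  by (intro DERIV_imp_deriv) simp

text \<open>Perturbing component \<open>k\<close> changes only row \<open>k\<close> of the gradient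
  arrays; the expansion in unit matrices matches this change with the directions in
  \<open>dFv_eq\<close> and \<open>dFw_eq\<close>.\<close>

lemma sum_scaleR_axis_axis:
  fixes \<beta> :: "'n::finite \<Rightarrow> real"
  shows "(\<Sum>i\<in>UNIV. \<beta> i *\<^sub>R axis k (axis i 1)) = (\<chi> k'. \<chi> i. if k' = k then \<beta> i else 0)"
  by (auto simp: vec_eq_iff axis_def if_distrib[of "\<lambda>x. x $ _"] if_distrib[of "\<lambda>x. _ * x"] cong: if_cong)

text \<open>The coefficient 0 for the other components gives all of them the form
  \<open>f + c * g\<close>, so one additivity rule serves every row.\<close>

lemma add_bump_axis_nth:
  "(u t + (h * bump c r t) *\<^sub>R axis k 1) $ k' = u t $ k' + (if k' = k then h else 0) * bump c r t"
  by (simp add: axis_def)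

lemma fgrad_add_bump:
  assumes ab: "\<forall>i. a $ i < b $ i"
    and kernL1: "\<forall>i. kern (1 - \<alpha> $ i) absolutely_integrable_on {0 <..< b $ i - a $ i}"
    and u: "\<forall>k. C1cl a b (\<lambda>t. u t $ k)" and t: "t \<in> cbox a b"
  shows "fgrad kern \<alpha> a b p q (\<lambda>t. u t + (h * bump c r t) *\<^sub>R axis k 1) t =
    fgrad kern \<alpha> a b p q u t +
    h *\<^sub>R (\<Sum>i\<in>UNIV. Bop kern (\<alpha> $ i) a b (p $ i) (q $ i) i (bump c r) t *\<^sub>R axis k (axis i 1))"
proof -
  have "Bop kern (\<alpha> $ i) a b (p $ i) (q $ i) i (\<lambda>t. u t $ k' + (if k' = k then h else 0) * bump c r t) t =
      Bop kern (\<alpha> $ i) a b (p $ i) (q $ i) i (\<lambda>t. u t $ k') t +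
      (if k' = k then h else 0) * Bop kern (\<alpha> $ i) a b (p $ i) (q $ i) i (bump c r) t" for i k'
    using assms by (intro Bop_add_scaled C1cl_bump) auto
  then show ?thesis
    unfolding sum_scaleR_axis_axis fgrad_def add_bump_axis_nth by (simp add: vec_eq_iff)
qed

lemma cgrad_add_bump:
  assumes ab: "\<forall>i. a $ i < b $ i"
    and u: "\<forall>k. C1cl a b (\<lambda>t. u t $ k)" and t: "t \<in> cbox a b"
  shows "cgrad a b (\<lambda>t. u t + (h * bump c r t) *\<^sub>R axis k 1) t =
    cgrad a b u t + h *\<^sub>R (\<Sum>i\<in>UNIV. bump_pd c r i t *\<^sub>R axis k (axis i 1))"
proof -
  have "pd a b i (\<lambda>t. u t $ k' + (if k' = k then h else 0) * bump c r t) t =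
      pd a b i (\<lambda>t. u t $ k') t + (if k' = k then h else 0) * bump_pd c r i t" for i k'
    using assms pd_bump[of a i b t c r] by (subst pd_add_scaled) (auto intro: C1cl_bump)
  then show ?thesis
    unfolding sum_scaleR_axis_axis cgrad_def add_bump_axis_nth by (simp add: vec_eq_iff)
qed

lemma continuous_on_Bop_bump:
  fixes a b :: "real^'n"
  assumes "\<forall>i. a $ i < b $ i" "kern (1 - \<alpha>) absolutely_integrable_on {0<..<b $ i - a $ i}"
    and "r > 0" "cball c r \<subseteq> box a b"
  shows "continuous_on (cbox a b) (Bop kern \<alpha> a b p q i (bump c r))"
  using continuous_on_Kop_pd_bump[where kern=kern and \<gamma>="1 - \<alpha>", OF assms] by (simp add: Bop_def[abs_def])

lemma admissible_add_bump:
  assumes ab: "\<forall>i. a $ i < b $ i"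
    and kernL1: "\<forall>i. kern (1 - \<alpha> $ i) absolutely_integrable_on {0 <..< b $ i - a $ i}"
    and adm: "admissible kern \<alpha> a b p q \<psi> u" and r: "r > 0" "cball c r \<subseteq> box a b"
  shows "admissible kern \<alpha> a b p q \<psi> (\<lambda>t. u t + (h * bump c r t) *\<^sub>R axis k 1)"
  unfolding admissible_def add_bump_axis_nth
proof (intro conjI allI ballI)
  have u: "C1cl a b (\<lambda>t. u t $ k')" for k' using adm by (simp add: admissible_def)
  show "C1cl a b (\<lambda>t. u t $ k' + (if k' = k then h else 0) * bump c r t)" for k'
    by (intro C1cl_add_scaled C1cl_bump ab u)
  show "continuous_on (cbox a b) (Bop kern (\<alpha> $ i) a b (p $ i) (q $ i) i
      (\<lambda>t. u t $ k' + (if k' = k then h else 0) * bump c r t))" for k' i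
  proof -
    have "continuous_on (cbox a b) (\<lambda>t. Bop kern (\<alpha> $ i) a b (p $ i) (q $ i) i (\<lambda>t. u t $ k') t +
      (if k' = k then h else 0) * Bop kern (\<alpha> $ i) a b (p $ i) (q $ i) i (bump c r) t)"
      using adm kernL1 by (intro continuous_intros continuous_on_Bop_bump ab r) (auto simp: admissible_def)
    then show ?thesis
      using kernL1 by (subst continuous_on_cong[OF refl Bop_add_scaled[OF ab _ u C1cl_bump[OF ab]]]) auto
  qed
  show "u t + (h * bump c r t) *\<^sub>R axis k 1 = \<psi> t" if "t \<in> cbox a b - box a b" for t
  proof -
    have "t \<notin> ball c r" using that r ball_subset_cball by blast
    then have "bump c r t = 0" by (rule bump_outside(1)[OF r(1)])
    then show ?thesis using adm that by (simp add: admissible_def)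
  qed
qed

section \<open>Localization and the Euler-Lagrange equation\<close>

text \<open>The constant factor \<open>E c\<close> removes the distinction of signs:
  \<open>E c * E t\<close> is positive near \<open>c\<close>, so a bump of small radius makes the
  integrand nonnegative.\<close>

lemma fundamental_lemma_bump:
  fixes E :: "real^'n \<Rightarrow> real"
  assumes E: "continuous_on (cbox a b) E" and c: "c \<in> box a b"
    and zero: "\<And>r. r > 0 \<Longrightarrow> cball c r \<subseteq> box a b \<Longrightarrow> ((\<lambda>t. E t * bump c r t) has_integral 0) (cbox a b)"
  shows "E c = 0"
proof (rule ccontr)
  assume "E c \<noteq> 0"
  then have pos: "0 < E c * E c" using not_real_square_gt_zero by blast
  define U where "U = box a b \<inter> (\<lambda>t. E c * E t) -` {0<..}"
  have "continuous_on (box a b) (\<lambda>t. E c * E t)"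
    by (intro continuous_intros continuous_on_subset[OF E box_subset_cbox])
  then have "open U"
    unfolding U_def by (rule continuous_open_preimage) auto
  moreover have "c \<in> U" using c pos by (simp add: U_def)
  ultimately obtain r where r: "r > 0" "cball c r \<subseteq> U"
    using open_contains_cball by blast
  then have sub: "cball c r \<subseteq> box a b" by (auto simp: U_def)
  have "E c * E c * bump c r c = 0"
  \<comment> \<open>A continuous nonnegative function with integral 0 vanishes at every point of the
    box, in particular at \<open>c\<close>.\<close>
  proof (rule has_integral_0_cbox_imp_0[of a b "\<lambda>t. E c * E t * bump c r t"])
    show "continuous_on (cbox a b) (\<lambda>t. E c * E t * bump c r t)"
      by (intro continuous_intros E continuous_on_bump)
    show "0 \<le> E c * E t * bump c r t" for t
    proof (cases "t \<in> ball c r")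
      case True
      then have "t \<in> U" using r(2) ball_subset_cball by blast
      then show ?thesis using bump_nonneg[of c r t] by (simp add: U_def)
    next
      case False
      then show ?thesis by (simp add: bump_outside(1)[OF r(1)])
    qed
    show "((\<lambda>t. E c * E t * bump c r t) has_integral 0) (cbox a b)"
      using has_integral_mult_right[OF zero[OF r(1) sub], of "E c"] by (simp add: mult.assoc)
    show "box a b \<noteq> {}" "c \<in> cbox a b" using c box_subset_cbox[of a b] by auto
  qed
  then show False using \<open>E c \<noteq> 0\<close> bump_center_pos[OF r(1), of c] by simp
qed

theorem mainTheorem4:
  fixes kern :: "real \<Rightarrow> real \<Rightarrow> real"
    and a b \<alpha> p1 q1 :: "real^'n"
    and F :: "real^'n \<Rightarrow> real^'m \<Rightarrow> real^'n^'m \<Rightarrow> real^'n^'m \<Rightarrow> real"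
    and \<psi> u :: "real^'n \<Rightarrow> real^'m"
  assumes ab: "\<forall>i. a $ i < b $ i"
    and alpha: "\<forall>i. 0 < \<alpha> $ i \<and> \<alpha> $ i < 1"
    and kernL1: "\<forall>i. kern (1 - \<alpha> $ i) absolutely_integrable_on {0 <..< b $ i - a $ i}"
    and FC2: "C2_on (cbox a b \<times> UNIV) (\<lambda>(t, x, v, w). F t x v w)"
    and adm: "admissible kern \<alpha> a b p1 q1 \<psi> u"
    and extr: "(\<forall>v. admissible kern \<alpha> a b p1 q1 \<psi> v \<longrightarrow>
                    Jfun kern \<alpha> a b p1 q1 F u \<le> Jfun kern \<alpha> a b p1 q1 F v) \<or>
               (\<forall>v. admissible kern \<alpha> a b p1 q1 \<psi> v \<longrightarrow>
                    Jfun kern \<alpha> a b p1 q1 F u \<ge> Jfun kern \<alpha> a b p1 q1 F v)"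
    and regV: "\<forall>i k. C1cl a b (Kop kern (1 - \<alpha> $ i) a b (q1 $ i) (p1 $ i) i
                 (\<lambda>t. dFv F k i t (u t) (fgrad kern \<alpha> a b p1 q1 u t) (cgrad a b u t)))"
    and regW: "\<forall>i k. C1cl a b
                 (\<lambda>t. dFw F k i t (u t) (fgrad kern \<alpha> a b p1 q1 u t) (cgrad a b u t))"
  shows "\<forall>k. \<forall>t \<in> box a b.
           (\<Sum>i\<in>UNIV.
              Aop kern (\<alpha> $ i) a b (q1 $ i) (p1 $ i) i
                (\<lambda>s. dFv F k i s (u s) (fgrad kern \<alpha> a b p1 q1 u s) (cgrad a b u s)) t
            + pd a b i
                (\<lambda>s. dFw F k i s (u s) (fgrad kern \<alpha> a b p1 q1 u s) (cgrad a b u s)) t)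
           = dFx F k t (u t) (fgrad kern \<alpha> a b p1 q1 u t) (cgrad a b u t)"
proof (intro allI ballI)
  fix k and c :: "real^'n"
  assume c: "c \<in> box a b"
  define G where "G = (\<lambda>(t, x, v, w). F t x v w)"
  obtain G1 G2 where G: "\<forall>z\<in>cbox a b \<times> UNIV. (G has_derivative blinfun_apply (G1 z)) (at z within cbox a b \<times> UNIV)"
    and G2: "\<forall>z\<in>cbox a b \<times> UNIV. (G1 has_derivative blinfun_apply (G2 z)) (at z within cbox a b \<times> UNIV)"
    using FC2 unfolding C2_on_def G_def by blast
  have G1: "continuous_on (cbox a b \<times> UNIV) G1"
    by (rule has_derivative_continuous_on) (rule G2[rule_format])
  define Z where "Z t = (t, u t, fgrad kern \<alpha> a b p1 q1 u t, cgrad a b u t)" for t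
  define Fx where "Fx t = dFx F k t (u t) (fgrad kern \<alpha> a b p1 q1 u t) (cgrad a b u t)" for t
  define Fv where "Fv i t = dFv F k i t (u t) (fgrad kern \<alpha> a b p1 q1 u t) (cgrad a b u t)" for i t
  define Fw where "Fw i t = dFw F k i t (u t) (fgrad kern \<alpha> a b p1 q1 u t) (cgrad a b u t)" for i t
  have Fx: "Fx t = G1 (Z t) (0, axis k 1, 0, 0)"
    and Fv: "Fv i t = G1 (Z t) (0, 0, axis k (axis i 1), 0)"
    and Fw: "Fw i t = G1 (Z t) (0, 0, 0, axis k (axis i 1))" if "t \<in> cbox a b" for i t
    using dFx_eq[OF G[unfolded G_def] that] dFv_eq[OF G[unfolded G_def] that] dFw_eq[OF G[unfolded G_def] that]
    by (simp_all add: Fx_def Fv_def Fw_def Z_def)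
  have u: "\<forall>k. C1cl a b (\<lambda>t. u t $ k)" using adm by (simp add: admissible_def)
  have "continuous_on (cbox a b) (\<lambda>t. \<chi> k. u t $ k)"
    using u by (intro continuous_on_vec_lambda) (simp add: C1cl_def)
  then have cu: "continuous_on (cbox a b) u" by simp
  have cf: "continuous_on (cbox a b) (fgrad kern \<alpha> a b p1 q1 u)"
    unfolding fgrad_def using adm by (intro continuous_on_vec_lambda) (simp add: admissible_def)
  have cc: "continuous_on (cbox a b) (cgrad a b u)"
    unfolding cgrad_def using u by (intro continuous_on_vec_lambda) (simp add: C1cl_def)
  have cZ: "continuous_on (cbox a b) Z"
    unfolding Z_def by (intro continuous_intros cu cf cc)
  have cG1: "continuous_on (cbox a b) (\<lambda>t. G1 (Z t))"
    by (rule continuous_on_compose2[OF G1 cZ]) (auto simp: Z_def)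
  have cFx: "continuous_on (cbox a b) Fx"
    by (subst continuous_on_cong[OF refl Fx]) (auto intro!: continuous_intros cG1)
  have cFv: "continuous_on (cbox a b) (Fv i)" for i
    by (subst continuous_on_cong[OF refl Fv]) (auto intro!: continuous_intros cG1)
  define A where "A i = pd a b i (Kop kern (1 - \<alpha> $ i) a b (q1 $ i) (p1 $ i) i (Fv i))" for i
  define W where "W i = pd a b i (Fw i)" for i
  have KV: "C1cl a b (Kop kern (1 - \<alpha> $ i) a b (q1 $ i) (p1 $ i) i (Fv i))" for i
    using regV by (simp add: Fv_def[abs_def])
  have FW: "C1cl a b (Fw i)" for i
    using regW by (simp add: Fw_def[abs_def])
  have cA: "continuous_on (cbox a b) (A i)" and cW: "continuous_on (cbox a b) (W i)"
    and cFw: "continuous_on (cbox a b) (Fw i)" for i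
    using KV[of i] FW[of i] by (auto simp: A_def W_def C1cl_def)
  \<comment> \<open>The defect in the Euler-Lagrange equation for component
    \<open>k\<close>.\<close>
  define E where "E t = Fx t - (\<Sum>i\<in>UNIV. A i t + W i t)" for t
  have cE: "continuous_on (cbox a b) E"
    unfolding E_def by (intro continuous_intros cFx cA cW)
  have "E c = 0"
  proof (rule fundamental_lemma_bump[OF cE c])
    fix r :: real
    assume r: "r > 0" "cball c r \<subseteq> box a b"
    let ?\<eta> = "bump c r" and ?\<eta>' = "bump_pd c r"
    let ?B = "\<lambda>i. Bop kern (\<alpha> $ i) a b (p1 $ i) (q1 $ i) i ?\<eta>"
    have cB: "continuous_on (cbox a b) (?B i)" for i
      using kernL1 by (intro continuous_on_Bop_bump ab r) auto
    define D where "D t = (0::real^'n, ?\<eta> t *\<^sub>R axis k 1 :: real^'m,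
      \<Sum>i\<in>UNIV. ?B i t *\<^sub>R axis k (axis i 1) :: real^'n^'m,
      \<Sum>i\<in>UNIV. ?\<eta>' i t *\<^sub>R axis k (axis i 1) :: real^'n^'m)" for t
    have cD: "continuous_on (cbox a b) D"
      unfolding D_def by (intro continuous_intros continuous_on_bump continuous_on_bump_pd cB)
    define j where "j h = integral (cbox a b) (\<lambda>t. G (Z t + h *\<^sub>R D t))" for h
    \<comment> \<open>By linearity of \<open>Bop\<close> and \<open>pd\<close> the perturbed
      argument is affine in \<open>h\<close>, with the same direction \<open>D\<close> for all
      \<open>h\<close>. The open and the closed box give the same integral.\<close>
    have j: "j h = Jfun kern \<alpha> a b p1 q1 F (\<lambda>t. u t + (h * ?\<eta> t) *\<^sub>R axis k 1)" for h
      unfolding Jfun_def integral_open_interval j_def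
    proof (rule integral_cong)
      fix t assume t: "t \<in> cbox a b"
      show "G (Z t + h *\<^sub>R D t) = F t (u t + (h * ?\<eta> t) *\<^sub>R axis k 1)
          (fgrad kern \<alpha> a b p1 q1 (\<lambda>t. u t + (h * ?\<eta> t) *\<^sub>R axis k 1) t)
          (cgrad a b (\<lambda>t. u t + (h * ?\<eta> t) *\<^sub>R axis k 1) t)"
        unfolding fgrad_add_bump[OF ab kernL1 u t] cgrad_add_bump[OF ab u t]
        by (simp add: G_def Z_def D_def)
    qed
    have j0: "j 0 = Jfun kern \<alpha> a b p1 q1 F u" unfolding j by simp
    have adm': "admissible kern \<alpha> a b p1 q1 \<psi> (\<lambda>t. u t + (h * ?\<eta> t) *\<^sub>R axis k 1)" for h
      by (rule admissible_add_bump[OF ab kernL1 adm r])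
    have "(j has_real_derivative integral (cbox a b) (\<lambda>t. G1 (Z t) (D t))) (at 0)"
      unfolding j_def by (rule has_real_derivative_first_variation[OF G G1 cZ _ cD]) (auto simp: Z_def D_def)
    moreover have "(\<forall>h. j 0 \<le> j h) \<or> (\<forall>h. j h \<le> j 0)"
      using extr adm' unfolding j0 unfolding j by blast
    \<comment> \<open>The inequality holds for all \<open>h\<close>, so the radius 1 in the local
      criteria is an arbitrary choice.\<close>
    ultimately have stationary: "integral (cbox a b) (\<lambda>t. G1 (Z t) (D t)) = 0"
      using DERIV_local_min[of j _ 0 1] DERIV_local_max[of j _ 0 1] by auto
    have G1D: "G1 (Z t) (D t) = Fx t * ?\<eta> t + (\<Sum>i\<in>UNIV. Fv i t * ?B i t + Fw i t * ?\<eta>' i t)"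
      if "t \<in> cbox a b" for t
    proof -
      have "D t = ?\<eta> t *\<^sub>R (0, axis k 1, 0, 0) + (\<Sum>i\<in>UNIV. ?B i t *\<^sub>R (0, 0, axis k (axis i 1), 0) +
          ?\<eta>' i t *\<^sub>R (0, 0, 0, axis k (axis i 1)))"
        by (simp add: D_def prod_eq_iff fst_sum snd_sum)
      then show ?thesis
        by (simp only: Fx[OF that] Fv[OF that] Fw[OF that] blinfun.add_right blinfun.sum_right
            blinfun.scaleR_right real_scaleR_def mult.commute)
    qed
    have zero: "integral (cbox a b) (\<lambda>t. Fx t * ?\<eta> t + (\<Sum>i\<in>UNIV. Fv i t * ?B i t + Fw i t * ?\<eta>' i t)) = 0"
      unfolding stationary[symmetric] by (rule integral_cong) (rule G1D[symmetric])
    have iFx: "(\<lambda>t. Fx t * ?\<eta> t) integrable_on cbox a b"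
      and iV: "(\<lambda>t. Fv i t * ?B i t) integrable_on cbox a b"
      and iW: "(\<lambda>t. Fw i t * ?\<eta>' i t) integrable_on cbox a b"
      and iA': "(\<lambda>t. A i t * ?\<eta> t) integrable_on cbox a b"
      and iW': "(\<lambda>t. W i t * ?\<eta> t) integrable_on cbox a b" for i
      by (intro integrable_continuous continuous_intros cFx cFv cFw cB cA cW continuous_on_bump continuous_on_bump_pd)+
    have byV: "integral (cbox a b) (\<lambda>t. Fv i t * ?B i t) = - integral (cbox a b) (\<lambda>t. A i t * ?\<eta> t)" for i
      unfolding Bop_def A_def using kernL1 by (intro integral_Kop_by_parts_bump ab r cFv KV) auto
    have byW: "integral (cbox a b) (\<lambda>t. Fw i t * ?\<eta>' i t) = - integral (cbox a b) (\<lambda>t. W i t * ?\<eta> t)" for i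
      unfolding W_def by (intro integral_by_parts_bump ab r FW)
    have "integral (cbox a b) (\<lambda>t. Fx t * ?\<eta> t + (\<Sum>i\<in>UNIV. Fv i t * ?B i t + Fw i t * ?\<eta>' i t)) =
        integral (cbox a b) (\<lambda>t. Fx t * ?\<eta> t) + (\<Sum>i\<in>UNIV. integral (cbox a b) (\<lambda>t. Fv i t * ?B i t) +
          integral (cbox a b) (\<lambda>t. Fw i t * ?\<eta>' i t))"
      by (intro integral_unique has_integral_add has_integral_sum integrable_integral iFx iV iW) auto
    \<comment> \<open>Each integration by parts has reversed a sign, which accounts for the minus in
      \<open>E\<close>.\<close>
    then have eq: "integral (cbox a b) (\<lambda>t. Fx t * ?\<eta> t) -
        (\<Sum>i\<in>UNIV. integral (cbox a b) (\<lambda>t. A i t * ?\<eta> t) + integral (cbox a b) (\<lambda>t. W i t * ?\<eta> t)) = 0"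
      unfolding zero byV byW by (simp add: sum.distrib sum_negf sum_subtractf)
    have "((\<lambda>t. Fx t * ?\<eta> t - (\<Sum>i\<in>UNIV. A i t * ?\<eta> t + W i t * ?\<eta> t)) has_integral 0) (cbox a b)"
      by (subst eq[symmetric])
         (intro has_integral_diff has_integral_sum has_integral_add integrable_integral iFx iA' iW', auto)
    then show "((\<lambda>t. E t * ?\<eta> t) has_integral 0) (cbox a b)"
      by (simp add: E_def left_diff_distrib sum_distrib_right distrib_right)
  qed
  then show "(\<Sum>i\<in>UNIV. Aop kern (\<alpha> $ i) a b (q1 $ i) (p1 $ i) i
                (\<lambda>s. dFv F k i s (u s) (fgrad kern \<alpha> a b p1 q1 u s) (cgrad a b u s)) c
            + pd a b i (\<lambda>s. dFw F k i s (u s) (fgrad kern \<alpha> a b p1 q1 u s) (cgrad a b u s)) c)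
           = dFx F k c (u c) (fgrad kern \<alpha> a b p1 q1 u c) (cgrad a b u c)"
    by (simp add: E_def A_def W_def Aop_def Fx_def Fv_def[abs_def] Fw_def[abs_def])
qed

end
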